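(* Let $\psi\in C([-1,1])$ be even and let $\mu$ be a finite signed Borel measure on $\mathbb S^{d-1}$ with $\mu(\mathbb S^{d-1})=1$. Then $$\sup_{K\in\mathcal K^d_\circ}\frac{1}{S(K)}\left|\int_{\mathbb S^{d-1}}\mathcal B_\psi K\,d\mu-\int_{\mathbb S^{d-1}}\mathcal B_\psi K\,d\sigma\right|=\frac12\,\|T_\psi(\mu-\sigma)\|_\infty .$$
   Context: Fix an integer $d\ge 2$. $\sigma$ is the normalized rotation-invariant Borel probability measure on the unit sphere $\mathbb S^{d-1}\subset\mathbb R^d$. $\mathcal K^d_\circ$ is the set of convex bodies (compact convex sets) in $\mathbb R^d$ with nonempty interior. For $K\in\mathcal K^d_\circ$, the surface area measure $S_K$ on $\mathbb S^{d-1}$ is the pushforward of $(d-1)$-dimensional Hausdorff measure on $\partial K$ under the ($\mathcal H^{d-1}$-a.e. defined) outer Gauss map, and $S(K):=S_K(\mathbb S^{d-1})$ is the surface area. For even $\psi\in C([-1,1])$ (real-valued), define $$\mathcal B_\psi K(u):=\frac12\int_{\mathbb S^{d-1}}\psi(\langle u,v\rangle)\,dS_K(v),\qquad u\in\mathbb S^{d-1}.$$ For a finite signed Borel measure $\nu$ on $\mathbb S^{d-1}$, define $(T_\psi\nu)(v):=\int_{\mathbb S^{d-1}}\psi(\langle u,v\rangle)\,d\nu(u)$ for $v\in\mathbb S^{d-1}$. $\|\cdot\|_\infty$ is the supremum norm on $\mathbb S^{d-1}$. *)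

theory Defs
  imports "HOL-Probability.Probability"
begin

text \<open>
  The normalization \<open>\<omega>\<^sub>s / 2\<^sup>s\<close>, with \<open>\<omega>\<^sub>s\<close> the volume of the \<open>s\<close>-dimensional unit ball, makes the
  measure agree with \<open>s\<close>-dimensional volume on \<open>s\<close>-dimensional submanifolds. Boundedness of the
  covering sets is required separately because \<^const>\<open>diameter\<close> is unspecified on unbounded sets;
  the case distinction is needed only for \<open>s = 0\<close>, where \<open>0 ^ 0 = 1\<close>.
\<close>

definition hausdorff_content :: "nat \<Rightarrow> real \<Rightarrow> 'a::metric_space set \<Rightarrow> ennreal" where
  "hausdorff_content s \<delta> A =
     (INF C \<in> {C :: nat \<Rightarrow> 'a set. A \<subseteq> (\<Union>i. C i) \<and> (\<forall>i. bounded (C i) \<and> diameter (C i) \<le> \<delta>)}.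
        \<Sum>i. if C i = {} then 0 else ennreal (unit_ball_vol (real s) * (diameter (C i) / 2) ^ s))"

definition hausdorff_measure :: "nat \<Rightarrow> 'a::metric_space measure" where
  "hausdorff_measure s =
     measure_of UNIV (sets borel) (\<lambda>A. SUP \<delta>\<in>{0<..}. hausdorff_content s \<delta> A)"

text \<open>
  A finite signed measure is a real-valued set function; only its values on \<^term>\<open>sets M\<close> matter.
\<close>

definition finite_signed_measure :: "'a measure \<Rightarrow> ('a set \<Rightarrow> real) \<Rightarrow> bool" where
  "finite_signed_measure M \<nu> \<longleftrightarrow>
     \<nu> {} = 0 \<and>
     (\<forall>A :: nat \<Rightarrow> 'a set. range A \<subseteq> sets M \<longrightarrow> disjoint_family A \<longrightarrow>
        (\<lambda>i. \<nu> (A i)) sums \<nu> (\<Union>i. A i))"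

text \<open>
  The positive part \<open>\<nu>\<^sup>+(A) = sup {\<nu>(B) | B \<subseteq> A}\<close> of the Jordan decomposition; the negative
  part of \<open>\<nu>\<close> is the positive part of \<open>-\<nu>\<close>. Negative values are truncated to \<open>0\<close> by \<^const>\<open>ennreal\<close>,
  which does not affect the supremum since \<open>\<nu> {} = 0\<close>.
\<close>

definition positive_part :: "'a measure \<Rightarrow> ('a set \<Rightarrow> real) \<Rightarrow> 'a measure" where
  "positive_part M \<nu> =
     measure_of (space M) (sets M) (\<lambda>A. SUP B\<in>{B \<in> sets M. B \<subseteq> A}. ennreal (\<nu> B))"

definition signed_integral :: "'a measure \<Rightarrow> ('a set \<Rightarrow> real) \<Rightarrow> ('a \<Rightarrow> real) \<Rightarrow> real" where
  "signed_integral M \<nu> f =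
     (\<integral>x. f x \<partial>positive_part M \<nu>) - (\<integral>x. f x \<partial>positive_part M (\<lambda>A. - \<nu> A))"

definition sphere_borel :: "(real ^ 'd) measure" where
  "sphere_borel = restrict_space borel (sphere 0 1)"

text \<open>For \<open>d \<ge> 2\<close> there is exactly one such measure.\<close>

definition rotation_invariant_prob :: "(real ^ 'd) measure \<Rightarrow> bool" where
  "rotation_invariant_prob \<sigma> \<longleftrightarrow>
     prob_space \<sigma> \<and> sets \<sigma> = sets sphere_borel \<and>
     (\<forall>Q. rotation_matrix Q \<longrightarrow> distr \<sigma> sphere_borel (\<lambda>x. Q *v x) = \<sigma>)"

definition convex_bodies :: "(real ^ 'd) set set" where
  "convex_bodies = {K. convex K \<and> compact K \<and> interior K \<noteq> {}}"

definition outer_unit_normals :: "(real ^ 'd) set \<Rightarrow> real ^ 'd \<Rightarrow> (real ^ 'd) set" where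
  "outer_unit_normals K x = {u \<in> sphere 0 1. \<forall>y\<in>K. u \<bullet> (y - x) \<le> 0}"

definition regular_boundary :: "(real ^ 'd) set \<Rightarrow> (real ^ 'd) set" where
  "regular_boundary K = {x \<in> frontier K. \<exists>!u. u \<in> outer_unit_normals K x}"

definition gauss_map :: "(real ^ 'd) set \<Rightarrow> real ^ 'd \<Rightarrow> real ^ 'd" where
  "gauss_map K x = (THE u. u \<in> outer_unit_normals K x)"

text \<open>
  The Gauss map of a convex body is defined on the regular boundary points; these form a Borel set
  whose complement in the boundary is null for the \<open>(d - 1)\<close>-dimensional Hausdorff measure.
\<close>

definition surface_area_measure :: "(real ^ 'd) set \<Rightarrow> (real ^ 'd) measure" where
  "surface_area_measure K =
     distr (restrict_space (hausdorff_measure (CARD('d) - 1)) (regular_boundary K))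
       sphere_borel (gauss_map K)"

definition surface_area :: "(real ^ 'd) set \<Rightarrow> real" where
  "surface_area K = measure (surface_area_measure K) (sphere 0 1)"

definition B_transform :: "(real \<Rightarrow> real) \<Rightarrow> (real ^ 'd) set \<Rightarrow> real ^ 'd \<Rightarrow> real" where
  "B_transform \<psi> K u = 1/2 * (\<integral>v. \<psi> (u \<bullet> v) \<partial>surface_area_measure K)"

definition T_transform :: "(real \<Rightarrow> real) \<Rightarrow> ((real ^ 'd) set \<Rightarrow> real) \<Rightarrow> real ^ 'd \<Rightarrow> real" where
  "T_transform \<psi> \<nu> v = signed_integral sphere_borel \<nu> (\<lambda>u. \<psi> (u \<bullet> v))"

text \<open>Extended-real valued, so that the supremum is meaningful without a boundedness proof.\<close>

definition sphere_sup_norm :: "(real ^ 'd \<Rightarrow> real) \<Rightarrow> ereal" where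
  "sphere_sup_norm f = (SUP v\<in>sphere 0 1. ereal \<bar>f v\<bar>)"

end

(*
By Fubini, the difference of the two averages of the B-transform of K is one half of the integral of
T(mu - sigma) against the surface area measure of K, which gives the upper bound (bodies whose
surface area measure is zero or infinite contribute 0, since 1 / 0 = 0). For the reverse inequality
let K be a flat lens, the intersection of two balls of radius R slightly larger than 1 centred at v
and -v: all its normals at regular boundary points are close to v or -v, and T(mu - sigma) is even
and continuous, so its normalized integral is close to its value at v. The size of the
surface area measure of the lens never enters; it only has to be positive and finite.
*)
theory Submission imports Defs begin

section \<open>Hausdorff measure is a Borel measure\<close>

text \<open>The obstacle is that the surface area measure rests on Hausdorff measure through
  \<open>measure_of\<close>, which returns the zero measure unless its set function is countably
  additive on the Borel sets. Until Caratheodory's criterion is verified, a lens could formally have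
  surface area 0. The same holds for \<open>positive_part\<close>, whose countable additivity and
  finiteness must be derived from the bare definition of a signed measure. A thin cylinder around v
  would also have most of its normals near v and -v, but its lateral normals are orthogonal to v,
  and their share of the surface would have to be estimated. The lens has such a defect only on its
  edge, where two normals compete and which is therefore not part of the regular boundary. Since
  only positivity and finiteness are wanted, crude volume comparisons suffice: packing balls into a
  spherical shell bounds the measure of a sphere from above, and the volume swept out by scaling a
  cap from the centre of its sphere bounds the measure of the cap from below, up to
  constants.\<close>

definition covering_cost :: "nat \<Rightarrow> 'a::metric_space set \<Rightarrow> ennreal" where
  "covering_cost s A = (if A = {} then 0 else ennreal (unit_ball_vol (real s) * (diameter A / 2) ^ s))"

text \<open>The estimates are made for this outer measure on arbitrary sets; it agrees with
  \<open>hausdorff_measure\<close> on Borel sets once additivity there is known.\<close>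

definition hausdorff_outer :: "nat \<Rightarrow> 'a::metric_space set \<Rightarrow> ennreal" where
  "hausdorff_outer s A = (SUP \<delta>\<in>{0<..}. hausdorff_content s \<delta> A)"

lemma hausdorff_content_eq:
  "hausdorff_content s \<delta> A =
     (INF C \<in> {C. A \<subseteq> (\<Union>i. C i) \<and> (\<forall>i. bounded (C i) \<and> diameter (C i) \<le> \<delta>)}.
        \<Sum>i. covering_cost s (C i))"
  unfolding hausdorff_content_def covering_cost_def ..

lemma covering_cost_empty [simp]: "covering_cost s {} = 0"
  by (simp add: covering_cost_def)

lemma hausdorff_content_le:
  assumes "A \<subseteq> (\<Union>i. C i)" "\<And>i. bounded (C i)" "\<And>i. diameter (C i) \<le> \<delta>"
  shows "hausdorff_content s \<delta> A \<le> (\<Sum>i. covering_cost s (C i))"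
  unfolding hausdorff_content_eq by (rule INF_lower) (use assms in auto)

lemma hausdorff_content_mono: "A \<subseteq> B \<Longrightarrow> hausdorff_content s \<delta> A \<le> hausdorff_content s \<delta> B"
  unfolding hausdorff_content_eq by (rule INF_superset_mono) auto

lemma hausdorff_content_antimono:
  "\<delta> \<le> \<epsilon> \<Longrightarrow> hausdorff_content s \<epsilon> A \<le> hausdorff_content s \<delta> A"
  unfolding hausdorff_content_eq by (rule INF_superset_mono) (auto intro: order.trans)

lemma hausdorff_content_empty: "0 \<le> \<delta> \<Longrightarrow> hausdorff_content s \<delta> {} = 0"
  using hausdorff_content_le[of "{}" "\<lambda>_. {}" \<delta> s] by simp

lemma hausdorff_content_close:
  assumes "hausdorff_content s \<delta> A < top" "0 < e"
  obtains C where "A \<subseteq> (\<Union>i. C i)" "\<And>i. bounded (C i)" "\<And>i. diameter (C i) \<le> \<delta>"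
    "(\<Sum>i. covering_cost s (C i)) \<le> hausdorff_content s \<delta> A + e"
proof -
  have "hausdorff_content s \<delta> A < hausdorff_content s \<delta> A + e"
    using assms by (metis add.right_neutral ennreal_add_left_cancel_less infinity_ennreal_def less_top)
  then obtain C where "A \<subseteq> (\<Union>i. C i)" "\<forall>i. bounded (C i) \<and> diameter (C i) \<le> \<delta>"
    "(\<Sum>i. covering_cost s (C i)) < hausdorff_content s \<delta> A + e"
    unfolding hausdorff_content_eq[of s \<delta> A] INF_less_iff by auto
  then show ?thesis by (intro that[of C]) auto
qed

lemma hausdorff_content_UN:
  "hausdorff_content s \<delta> (\<Union>i. A i) \<le> (\<Sum>i. hausdorff_content s \<delta> (A i))"
proof (cases "\<forall>i. hausdorff_content s \<delta> (A i) < top")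
  case False
  then have "(\<Sum>i. hausdorff_content s \<delta> (A i)) = top"
    by (metis ennreal_suminf_lessD top.not_eq_extremum)
  then show ?thesis by simp
next
  case True
  show ?thesis
  proof (rule ennreal_le_epsilon)
    fix e :: real assume "0 < e"
    have "\<exists>C. A n \<subseteq> (\<Union>i. C i) \<and> (\<forall>i. bounded (C i) \<and> diameter (C i) \<le> \<delta>) \<and>
        (\<Sum>i. covering_cost s (C i)) \<le> hausdorff_content s \<delta> (A n) + ennreal (e * (1/2)^Suc n)" for n
      using hausdorff_content_close[of s \<delta> "A n" "ennreal (e * (1/2)^Suc n)"] True \<open>0 < e\<close>
      by (metis ennreal_less_zero_iff half_gt_zero_iff mult_pos_pos zero_less_one zero_less_power)
    then obtain C where C: "\<And>n. A n \<subseteq> (\<Union>i. C n i)"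
      "\<And>n i. bounded (C n i)" "\<And>n i. diameter (C n i) \<le> \<delta>"
      "\<And>n. (\<Sum>i. covering_cost s (C n i)) \<le> hausdorff_content s \<delta> (A n) + ennreal (e * (1/2)^Suc n)"
      by metis
    define D where "D = case_prod C \<circ> prod_decode"
    have "(\<Union>i. A i) \<subseteq> (\<Union>i. D i)"
    proof
      fix x assume "x \<in> (\<Union>i. A i)"
      then obtain n i where "x \<in> C n i" using C(1) by blast
      then have "x \<in> D (prod_encode (n, i))" by (simp add: D_def)
      then show "x \<in> (\<Union>i. D i)" by blast
    qed
    then have "hausdorff_content s \<delta> (\<Union>i. A i) \<le> (\<Sum>i. covering_cost s (D i))"
      by (rule hausdorff_content_le) (auto simp: D_def C split: prod.split)
    also have "\<dots> = (\<Sum>n. \<Sum>i. covering_cost s (C n i))"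
      unfolding D_def
      using suminf_ennreal_2dimen[of "\<lambda>n. \<Sum>i. covering_cost s (C n i)" "\<lambda>(n, i). covering_cost s (C n i)"]
      by (simp add: split_def)
    also have "\<dots> \<le> (\<Sum>n. hausdorff_content s \<delta> (A n) + ennreal (e * (1/2)^Suc n))"
      by (intro suminf_le C) auto
    also have "\<dots> = (\<Sum>n. hausdorff_content s \<delta> (A n)) + (\<Sum>n. ennreal (e * (1/2)^Suc n))"
      by (rule suminf_add[symmetric]) auto
    also have "(\<Sum>n. ennreal (e * (1/2)^Suc n)) = ennreal e"
      using \<open>0 < e\<close> power_half_series by (intro suminf_ennreal_eq) (auto dest: sums_mult[where c=e])
    finally show "hausdorff_content s \<delta> (\<Union>i. A i) \<le> (\<Sum>i. hausdorff_content s \<delta> (A i)) + ennreal e" .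
  qed
qed

lemma hausdorff_outer_mono: "A \<subseteq> B \<Longrightarrow> hausdorff_outer s A \<le> hausdorff_outer s B"
  unfolding hausdorff_outer_def by (intro SUP_mono) (use hausdorff_content_mono in blast)

lemma hausdorff_content_le_outer: "0 < \<delta> \<Longrightarrow> hausdorff_content s \<delta> A \<le> hausdorff_outer s A"
  unfolding hausdorff_outer_def by (rule SUP_upper) auto

lemma hausdorff_outer_empty [simp]: "hausdorff_outer s {} = 0"
  by (simp add: hausdorff_outer_def hausdorff_content_empty)

lemma hausdorff_outer_UN: "hausdorff_outer s (\<Union>i. A i) \<le> (\<Sum>i. hausdorff_outer s (A i))"
proof -
  have "hausdorff_content s \<delta> (\<Union>i. A i) \<le> (\<Sum>i. hausdorff_outer s (A i))" if "0 < \<delta>" for \<delta>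
    by (rule order.trans[OF hausdorff_content_UN suminf_le])
       (use that hausdorff_content_le_outer in auto)
  then show ?thesis
    unfolding hausdorff_outer_def[of s "\<Union>i. A i"] by (intro SUP_least) auto
qed

lemma outer_measure_space_hausdorff_outer: "outer_measure_space (Pow UNIV) (hausdorff_outer s)"
  using hausdorff_outer_UN hausdorff_outer_mono
  by (auto simp: outer_measure_space_def positive_def increasing_def countably_subadditive_def)

lemma hausdorff_outer_Un:
  fixes A :: "'a::metric_space set"
  shows "hausdorff_outer s (A \<union> B) \<le> hausdorff_outer s A + hausdorff_outer s B"
proof -
  interpret P: sigma_algebra UNIV "Pow UNIV :: 'a set set" by (rule sigma_algebra_Pow)
  have "subadditive (Pow UNIV) (hausdorff_outer s :: 'a set \<Rightarrow> ennreal)"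
    using outer_measure_space_hausdorff_outer[of s]
    by (intro P.countably_subadditive_subadditive) (auto simp: outer_measure_space_def)
  then have "hausdorff_outer s (A \<union> (B - A)) \<le> hausdorff_outer s A + hausdorff_outer s (B - A)"
    by (intro subadditiveD[where M="Pow UNIV"]) auto
  also have "\<dots> \<le> hausdorff_outer s A + hausdorff_outer s B"
    by (intro add_left_mono hausdorff_outer_mono) auto
  finally show ?thesis by simp
qed

section \<open>Additivity on separated sets and Caratheodory's criterion\<close>

lemma hausdorff_outer_separated:
  assumes "0 < e" and sep: "\<And>x y. x \<in> A \<Longrightarrow> y \<in> B \<Longrightarrow> e \<le> dist x y"
  shows "hausdorff_outer s A + hausdorff_outer s B \<le> hausdorff_outer s (A \<union> B)"
proof -
  have *: "hausdorff_content s \<delta> A + hausdorff_content s \<delta> B \<le> hausdorff_content s \<delta> (A \<union> B)"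
    if \<delta>: "0 < \<delta>" "\<delta> < e" for \<delta>
    unfolding hausdorff_content_eq[of s \<delta> "A \<union> B"]
  proof (rule INF_greatest)
    fix C :: "nat \<Rightarrow> 'a set" assume "C \<in> {C. A \<union> B \<subseteq> (\<Union>i. C i) \<and> (\<forall>i. bounded (C i) \<and> diameter (C i) \<le> \<delta>)}"
    then have C: "A \<union> B \<subseteq> (\<Union>i. C i)" "\<And>i. bounded (C i)" "\<And>i. diameter (C i) \<le> \<delta>" by auto
    \<comment> \<open>A set of diameter less than \<open>e\<close> cannot meet both \<open>A\<close>
      and \<open>B\<close>, so the two subfamilies never share a set. Discarded sets become empty
      ones, which cost 0 even when \<open>s = 0\<close>.\<close>
    define D where "D E i = (if C i \<inter> E = {} then {} else C i)" for E i
    have "D A i = {} \<or> D B i = {}" for i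
    proof (rule ccontr)
      assume "\<not> ?thesis"
      then obtain x y where "x \<in> C i" "x \<in> A" "y \<in> C i" "y \<in> B"
        by (auto simp: D_def split: if_splits)
      then have "e \<le> dist x y" "dist x y \<le> \<delta>"
        using sep diameter_bounded_bound[OF C(2)] C(3) order.trans by blast+
      with \<delta> show False by simp
    qed
    then have cost: "covering_cost s (D A i) + covering_cost s (D B i) \<le> covering_cost s (C i)" for i
      by (metis D_def add.left_neutral add.right_neutral covering_cost_empty order_refl zero_le)
    have "hausdorff_content s \<delta> E \<le> (\<Sum>i. covering_cost s (D E i))" if "E \<subseteq> A \<union> B" for E
    proof (rule hausdorff_content_le)
      show "E \<subseteq> (\<Union>i. D E i)" using that C(1) by (fastforce simp: D_def)
    qed (use C \<delta> in \<open>auto simp: D_def\<close>)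
    then have "hausdorff_content s \<delta> A + hausdorff_content s \<delta> B
        \<le> (\<Sum>i. covering_cost s (D A i)) + (\<Sum>i. covering_cost s (D B i))"
      by (intro add_mono) auto
    also have "\<dots> = (\<Sum>i. covering_cost s (D A i) + covering_cost s (D B i))"
      by (rule suminf_add) auto
    also have "\<dots> \<le> (\<Sum>i. covering_cost s (C i))"
      by (intro suminf_le cost) auto
    finally show "hausdorff_content s \<delta> A + hausdorff_content s \<delta> B \<le> (\<Sum>i. covering_cost s (C i))" .
  qed
  have "hausdorff_content s \<alpha> A + hausdorff_content s \<beta> B \<le> hausdorff_outer s (A \<union> B)"
    if "0 < \<alpha>" "0 < \<beta>" for \<alpha> \<beta>
  proof -
    \<comment> \<open>The two suprema run over independent scales; a common finer scale below
      \<open>e\<close> dominates both contents.\<close>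
    define \<delta> where "\<delta> = min (e/2) (min \<alpha> \<beta>)"
    have \<delta>: "0 < \<delta>" "\<delta> < e" "\<delta> \<le> \<alpha>" "\<delta> \<le> \<beta>" using that assms(1) by (auto simp: \<delta>_def)
    have "hausdorff_content s \<alpha> A + hausdorff_content s \<beta> B
      \<le> hausdorff_content s \<delta> A + hausdorff_content s \<delta> B"
      by (intro add_mono hausdorff_content_antimono \<delta>)
    also have "\<dots> \<le> hausdorff_outer s (A \<union> B)"
      using *[OF \<delta>(1,2)] hausdorff_content_le_outer[OF \<delta>(1)] order.trans by blast
    finally show ?thesis .
  qed
  then show ?thesis
    unfolding hausdorff_outer_def[of s A] hausdorff_outer_def[of s B]
    by (auto simp: ennreal_SUP_add_left[symmetric] ennreal_SUP_add_right intro!: SUP_least)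
qed

text \<open>
  The points of \<open>X - F\<close> are sorted into layers \<open>R k\<close> by their distance to \<open>F\<close>. Layers whose indices
  differ by at least two are separated, so the outer measures of the layers are summable.
\<close>
lemma hausdorff_outer_closed_split:
  assumes "closed F"
  shows "hausdorff_outer s (X \<inter> F) + hausdorff_outer s (X - F) \<le> hausdorff_outer s X"
proof (cases "F = {} \<or> hausdorff_outer s X = top")
  case True
  then show ?thesis by auto
next
  case False
  let ?H = "hausdorff_outer s"
  \<comment> \<open>Since \<open>infdist\<close> to the empty set is 0 by convention, positivity of
    \<open>d\<close> off \<open>F\<close> needs the case split above.\<close>
  define d where "d x = infdist x F" for x
  have d_pos: "0 < d x" if "x \<notin> F" for x
    using False assms that in_closed_iff_infdist_zero[of F x] infdist_nonneg[of x F]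
    unfolding d_def by (metis less_eq_real_def)
  have d_zero: "d x = 0" if "x \<in> F" for x using that by (simp add: d_def)
  have d_lip: "d x - d y \<le> dist x y" for x y
    using infdist_triangle[of x F y] unfolding d_def by simp
  have sep: "?H A + ?H B \<le> ?H (A \<union> B)"
    if "a < b" "\<And>x. x \<in> A \<Longrightarrow> d x \<le> a" "\<And>x. x \<in> B \<Longrightarrow> b \<le> d x" for A B a b
  proof (rule hausdorff_outer_separated)
    fix x y assume "x \<in> A" "y \<in> B"
    then show "b - a \<le> dist x y"
      using that(2)[of x] that(3)[of y] d_lip[of y x] by (simp add: dist_commute)
  qed (use that(1) in simp)
  \<comment> \<open>For \<open>k > 0\<close> the layer is
    \<open>1 / (k + 1) < d x \<le> 1 / k\<close>, and \<open>R 0\<close> is \<open>d x > 1\<close>.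
    The points of \<open>Y n\<close> have \<open>d x > 1 / n\<close> and are thus separated from
    \<open>F\<close>.\<close>
  define R where "R k = {x \<in> X - F. real k \<le> 1 / d x \<and> 1 / d x < real k + 1}" for k :: nat
  define Y where "Y n = {x \<in> X - F. 1 / d x < real n}" for n :: nat
  have sumR: "(\<Sum>k<n. ?H (R (2 * k + j))) \<le> ?H X" for j n :: nat
  proof -
    have "(\<Sum>k<n. ?H (R (2 * k + j))) \<le> ?H (\<Union>k<n. R (2 * k + j))"
    proof (induction n)
      case (Suc n)
      have "?H (R (2 * n + j)) + ?H (\<Union>k<n. R (2 * k + j)) \<le> ?H (R (2 * n + j) \<union> (\<Union>k<n. R (2 * k + j)))"
      proof (cases n)
        case (Suc m)
        show ?thesis
        proof (rule sep)
          \<comment> \<open>Now \<open>n > 0\<close>, so \<open>2 * n + j \<ge> 2\<close> and both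
            bounds are positive. The new layer has \<open>d x \<le> 1 / (2 * n + j)\<close>, while
            the earlier layers of the same parity have \<open>d x\<close> at least the larger
            bound.\<close>
          show "1 / real (2 * n + j) < 1 / (real (2 * n + j) - 1)"
            using Suc by (intro divide_strict_left_mono) auto
          show "d x \<le> 1 / real (2 * n + j)" if "x \<in> R (2 * n + j)" for x
            using that d_pos[of x] Suc by (simp add: R_def field_simps)
          show "1 / (real (2 * n + j) - 1) \<le> d x" if x: "x \<in> (\<Union>k<n. R (2 * k + j))" for x
          proof -
            obtain k where k: "k < n" "x \<in> R (2 * k + j)" using x by auto
            then have "1 / d x < real (2 * k + j) + 1" "0 < d x" using d_pos by (auto simp: R_def)
            moreover have "real (2 * k + j) + 1 \<le> real (2 * n + j) - 1"
              using k(1) by linarith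
            ultimately have "1 / d x \<le> real (2 * n + j) - 1" by linarith
            moreover have "0 < real (2 * n + j) - 1" using Suc by simp
            ultimately show ?thesis using \<open>0 < d x\<close> by (simp add: field_simps)
          qed
        qed
      qed simp
      moreover have "(\<Union>k<Suc n. R (2 * k + j)) = R (2 * n + j) \<union> (\<Union>k<n. R (2 * k + j))"
        by (simp add: lessThan_Suc)
      ultimately show ?case
        using add_left_mono[OF Suc.IH, of "?H (R (2 * n + j))"]
        by (metis (no_types, lifting) add.commute order.trans sum.lessThan_Suc)
    qed simp
    also have "\<dots> \<le> ?H X" by (rule hausdorff_outer_mono) (auto simp: R_def)
    finally show ?thesis .
  qed
  \<comment> \<open>Layers of even index and layers of odd index each contribute at most
    \<open>?H X\<close>.\<close>
  have "(\<Sum>k<n. ?H (R k)) \<le> ?H X + ?H X" for n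
  proof -
    have "(\<Sum>k<n. ?H (R k)) \<le> (\<Sum>k<2 * n. ?H (R k))" by (rule sum_mono2) auto
    also have "\<dots> = (\<Sum>k<n. ?H (R (2 * k))) + (\<Sum>k<n. ?H (R (2 * k + 1)))"
      by (induction n) (auto simp: algebra_simps)
    also have "\<dots> \<le> ?H X + ?H X" using sumR[of 0 n] sumR[of 1 n] by (intro add_mono) auto
    finally show ?thesis .
  qed
  then have "(\<Sum>k. ?H (R k)) \<le> ?H X + ?H X" by (intro suminf_le_const) auto
  then have fin: "(\<Sum>k. ?H (R k)) < top"
    using False by (metis ennreal_add_eq_top leD top.not_eq_extremum)
  have HR_fin: "?H (R k) < top" for k
    using fin ennreal_suminf_lessD by blast
  define r where "r k = enn2real (?H (R k))" for k
  have r: "?H (R k) = ennreal (r k)" "0 \<le> r k" for k using HR_fin[of k] by (auto simp: r_def)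
  have "summable r" using fin r by (metis (no_types, lifting) ext summable_suminf_not_top less_irrefl)
  have Y: "?H (X \<inter> F) + ?H (Y n) \<le> ?H X" if "0 < n" for n
  proof -
    have "?H (X \<inter> F) + ?H (Y n) \<le> ?H ((X \<inter> F) \<union> Y n)"
    proof (rule sep)
      show "0 < 1 / real n" using that by simp
      show "1 / real n \<le> d x" if x: "x \<in> Y n" for x
        using x d_pos[of x] \<open>0 < n\<close> by (auto simp: Y_def field_simps)
    qed (simp add: d_zero)
    also have "\<dots> \<le> ?H X" by (rule hausdorff_outer_mono) (auto simp: Y_def)
    finally show ?thesis .
  qed
  \<comment> \<open>What \<open>Y n\<close> misses lies in the layers of index at least
    \<open>n\<close>, whose total is the tail of a convergent series and vanishes as
    \<open>n\<close> grows.\<close>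
  have "?H (X \<inter> F) + ?H (X - F) \<le> ?H X + ennreal (\<Sum>k. r (k + n))" if "0 < n" for n
  proof -
    have "X - F \<subseteq> Y n \<union> (\<Union>k. R (k + n))"
    proof
      fix x assume x: "x \<in> X - F"
      show "x \<in> Y n \<union> (\<Union>k. R (k + n))"
      proof (cases "1 / d x < real n")
        case True with x show ?thesis by (simp add: Y_def)
      next
        case nless: False
        define m where "m = nat \<lfloor>1 / d x\<rfloor>"
        have "0 < d x" using x d_pos by auto
        then have "0 \<le> 1 / d x" by simp
        then have m: "real m \<le> 1 / d x" "1 / d x < real m + 1" unfolding m_def by linarith+
        then have "n \<le> m" using nless by linarith
        then have "x \<in> R ((m - n) + n)" using m x by (simp add: R_def)
        then show ?thesis by blast
      qed
    qed
    then have "?H (X - F) \<le> ?H (Y n) + ?H (\<Union>k. R (k + n))"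
      using hausdorff_outer_mono hausdorff_outer_Un order.trans by blast
    also have "?H (\<Union>k. R (k + n)) \<le> (\<Sum>k. ?H (R (k + n)))" by (rule hausdorff_outer_UN)
    also have "(\<Sum>k. ?H (R (k + n))) = ennreal (\<Sum>k. r (k + n))"
      unfolding r(1) using \<open>summable r\<close> r(2)
      by (intro suminf_ennreal2) (auto simp: summable_iff_shift)
    finally have "?H (X \<inter> F) + ?H (X - F) \<le> ?H (X \<inter> F) + (?H (Y n) + ennreal (\<Sum>k. r (k + n)))"
      by (simp add: add_left_mono)
    also have "\<dots> \<le> ?H X + ennreal (\<Sum>k. r (k + n))"
      using Y[OF that] by (simp add: add.assoc[symmetric] add_right_mono)
    finally show ?thesis .
  qed
  then have "\<forall>\<^sub>F n in sequentially. ?H (X \<inter> F) + ?H (X - F) \<le> ?H X + ennreal (\<Sum>k. r (k + n))"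
    by (auto simp: eventually_sequentially intro!: exI[of _ 1])
  moreover have "(\<lambda>n. ?H X + ennreal (\<Sum>k. r (k + n))) \<longlonglongrightarrow> ?H X + ennreal 0"
    using suminf_exist_split2[OF \<open>summable r\<close>]
    by (intro tendsto_add tendsto_const tendsto_ennrealI) auto
  ultimately have "?H (X \<inter> F) + ?H (X - F) \<le> ?H X + ennreal 0"
    by (metis tendsto_lowerbound trivial_limit_sequentially)
  then show ?thesis by simp
qed

text \<open>The closed sets satisfy Caratheodory's criterion; the sets satisfying it form a
  sigma-algebra, which therefore contains all Borel sets.\<close>

lemma measure_space_hausdorff_outer:
  "measure_space UNIV (sets borel) (hausdorff_outer s :: 'a::metric_space set \<Rightarrow> ennreal)"
proof -
  let ?L = "lambda_system UNIV (Pow UNIV) (hausdorff_outer s :: 'a set \<Rightarrow> ennreal)"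
  interpret P: sigma_algebra UNIV "Pow UNIV :: 'a set set" by (rule sigma_algebra_Pow)
  have L: "measure_space UNIV ?L (hausdorff_outer s)"
    by (rule P.caratheodory_lemma[OF outer_measure_space_hausdorff_outer])
  have closed: "F \<in> ?L" if "closed F" for F
  proof -
    have "hausdorff_outer s (X \<inter> F) + hausdorff_outer s (X - F) = hausdorff_outer s X" for X
      using hausdorff_outer_closed_split[OF that, of s X] hausdorff_outer_Un[of s "X \<inter> F" "X - F"]
      by (intro antisym) (simp_all add: Int_Diff_Un)
    then show ?thesis by (subst P.lambda_system_eq) simp
  qed
  have "sigma_sets UNIV (Collect closed) \<subseteq> ?L"
    using L closed by (intro sigma_algebra.sigma_sets_subset) (auto simp: measure_space_def)
  then have "sets borel \<subseteq> ?L" by (simp add: borel_eq_closed)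
  then show ?thesis
    by (intro measure_down[OF L]) (auto intro: sets.sigma_algebra_axioms[of borel, simplified])
qed

lemma space_hausdorff_measure [simp]: "space (hausdorff_measure s) = UNIV"
  by (simp add: hausdorff_measure_def)

lemma sets_hausdorff_measure [simp, measurable_cong]: "sets (hausdorff_measure s) = sets borel"
  unfolding hausdorff_measure_def
  using sets.sets_measure_of_eq[of borel] by simp

lemma emeasure_hausdorff_measure:
  "A \<in> sets borel \<Longrightarrow> emeasure (hausdorff_measure s) A = hausdorff_outer s A"
  using measure_space_hausdorff_outer[of s]
  by (subst hausdorff_measure_def)
     (auto simp: hausdorff_outer_def[abs_def] measure_space_def
       intro: emeasure_measure_of_sigma)

section \<open>Hausdorff measure of spherical pieces\<close>

lemma power_diff_le:
  fixes a b :: real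
  assumes "0 \<le> b" "b \<le> a"
  shows "a ^ Suc m - b ^ Suc m \<le> real (Suc m) * (a - b) * a ^ m"
proof (induction m)
  case (Suc m)
  have "a ^ Suc (Suc m) - b ^ Suc (Suc m) = a * (a ^ Suc m - b ^ Suc m) + (a - b) * b ^ Suc m"
    by (simp add: algebra_simps)
  also have "\<dots> \<le> a * (real (Suc m) * (a - b) * a ^ m) + (a - b) * a ^ Suc m"
    using assms Suc by (intro add_mono mult_left_mono power_mono) auto
  also have "\<dots> = real (Suc (Suc m)) * (a - b) * a ^ Suc m"
    by (simp add: algebra_simps)
  finally show ?case .
qed simp

lemma hausdorff_content_le_card:
  fixes A :: "'a::euclidean_space set"
  assumes "finite X" "A \<subseteq> (\<Union>x\<in>X. cball x r)" "0 \<le> r" "2 * r \<le> \<delta>"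
  shows "hausdorff_content s \<delta> A \<le> ennreal (real (card X) * (unit_ball_vol (real s) * r ^ s))"
proof -
  obtain h where h: "bij_betw h {0..<card X} X"
    using ex_bij_betw_nat_finite[OF assms(1)] by auto
  define C where "C i = (if i < card X then cball (h i) r else {})" for i
  have "hausdorff_content s \<delta> A \<le> (\<Sum>i. covering_cost s (C i))"
  proof (rule hausdorff_content_le)
    show "A \<subseteq> (\<Union>i. C i)"
    proof
      fix y assume "y \<in> A"
      then obtain x where "x \<in> X" "y \<in> cball x r" using assms(2) by auto
      moreover obtain i where "i < card X" "h i = x"
        using h \<open>x \<in> X\<close> by (metis atLeastLessThan_iff bij_betw_iff_bijections)
      ultimately have "y \<in> C i" by (simp add: C_def)
      then show "y \<in> (\<Union>i. C i)" by blast
    qed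
    show "bounded (C i)" "diameter (C i) \<le> \<delta>" for i
      using assms by (auto simp: C_def)
  qed
  also have "\<dots> = (\<Sum>i<card X. covering_cost s (C i))"
    by (intro suminf_finite) (auto simp: C_def)
  also have "\<dots> = (\<Sum>i<card X. ennreal (unit_ball_vol (real s) * r ^ s))"
    using assms(3) by (intro sum.cong) (auto simp: C_def covering_cost_def)
  also have "\<dots> = ennreal (real (card X) * (unit_ball_vol (real s) * r ^ s))"
    using assms(3) by (subst sum_ennreal) (auto intro!: mult_nonneg_nonneg)
  finally show ?thesis .
qed

text \<open>Disjoint balls around the points of \<open>X\<close> fit into a spherical shell of width \<open>2 * \<rho>\<close>.\<close>
lemma card_separated_sphere_le:
  fixes p :: "'a::euclidean_space"
  assumes dim: "DIM('a) = Suc m" and \<rho>: "0 < \<rho>" "\<rho> \<le> R"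
    and X: "finite X" "X \<subseteq> sphere p R" "\<And>x y. x \<in> X \<Longrightarrow> y \<in> X \<Longrightarrow> x \<noteq> y \<Longrightarrow> 2 * \<rho> \<le> dist x y"
  shows "real (card X) * \<rho> ^ m \<le> 2 * real (Suc m) * (2 * R) ^ m"
proof -
  let ?\<omega> = "unit_ball_vol (real (Suc m))"
  have ball: "emeasure lborel (ball x r) = ennreal (?\<omega> * r ^ Suc m)" if "0 \<le> r" for x :: 'a and r
    using emeasure_ball[OF that, of x] by (simp only: dim)
  have disj: "disjoint_family_on (\<lambda>x. ball x \<rho>) X"
    unfolding disjoint_family_on_def
  proof (intro ballI impI)
    fix x y assume "x \<in> X" "y \<in> X" "x \<noteq> y"
    then show "ball x \<rho> \<inter> ball y \<rho> = {}"
      using X(3) by (intro disjoint_ballI) auto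
  qed
  have shell: "(\<Union>x\<in>X. ball x \<rho>) \<inter> ball p (R - \<rho>) = {}"
  proof -
    have False if "x \<in> X" "dist x y < \<rho>" "dist p y < R - \<rho>" for x y
      using that X(2) dist_triangle[of p x y] by (auto simp: dist_commute)
    then show ?thesis by auto
  qed
  have sub: "(\<Union>x\<in>X. ball x \<rho>) \<union> ball p (R - \<rho>) \<subseteq> ball p (R + \<rho>)"
  proof
    fix y assume "y \<in> (\<Union>x\<in>X. ball x \<rho>) \<union> ball p (R - \<rho>)"
    then show "y \<in> ball p (R + \<rho>)"
    proof
      assume "y \<in> (\<Union>x\<in>X. ball x \<rho>)"
      then obtain x where "x \<in> X" "dist x y < \<rho>" by auto
      then show ?thesis using X(2) dist_triangle[of p y x] by auto
    qed (use \<rho> in auto)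
  qed
  \<comment> \<open>Adding the inner ball, which is disjoint from the small ones, avoids the volume
    of the shell itself: only volumes of balls are compared.\<close>
  have "(\<Sum>x\<in>X. ennreal (?\<omega> * \<rho> ^ Suc m)) + ennreal (?\<omega> * (R - \<rho>) ^ Suc m)
      = (\<Sum>x\<in>X. emeasure lborel (ball x \<rho>)) + emeasure lborel (ball p (R - \<rho>))"
    using \<rho> by (simp add: ball)
  also have "\<dots> = emeasure lborel (\<Union>x\<in>X. ball x \<rho>) + emeasure lborel (ball p (R - \<rho>))"
    using X(1) disj by (subst sum_emeasure) auto
  also have "\<dots> = emeasure lborel ((\<Union>x\<in>X. ball x \<rho>) \<union> ball p (R - \<rho>))"
    using X(1) shell by (intro plus_emeasure) auto
  also have "\<dots> \<le> emeasure lborel (ball p (R + \<rho>))"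
    using sub by (intro emeasure_mono) auto
  also have "\<dots> = ennreal (?\<omega> * (R + \<rho>) ^ Suc m)"
    using \<rho> by (intro ball) auto
  finally have "ennreal (real (card X) * (?\<omega> * \<rho> ^ Suc m) + ?\<omega> * (R - \<rho>) ^ Suc m) \<le> ennreal (?\<omega> * (R + \<rho>) ^ Suc m)"
    using \<rho> by (subst (asm) sum_ennreal) (auto simp: ennreal_plus[symmetric] simp del: ennreal_plus power_Suc)
  then have "real (card X) * (?\<omega> * \<rho> ^ Suc m) + ?\<omega> * (R - \<rho>) ^ Suc m \<le> ?\<omega> * (R + \<rho>) ^ Suc m"
    using \<rho> by (subst (asm) ennreal_le_iff) auto
  then have "?\<omega> * (real (card X) * \<rho> ^ Suc m) \<le> ?\<omega> * ((R + \<rho>) ^ Suc m - (R - \<rho>) ^ Suc m)"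
    by (simp add: algebra_simps)
  moreover have "0 < ?\<omega>" by simp
  ultimately have "real (card X) * \<rho> ^ Suc m \<le> (R + \<rho>) ^ Suc m - (R - \<rho>) ^ Suc m"
    by (metis mult_le_cancel_left_pos)
  \<comment> \<open>The difference of powers is linear in the width \<open>2 * \<rho>\<close>.
    Cancelling one factor \<rho> leaves the exponent \<open>m\<close>, the dimension of the
    sphere.\<close>
  also have "\<dots> \<le> real (Suc m) * (2 * \<rho>) * (R + \<rho>) ^ m"
    using power_diff_le[of "R - \<rho>" "R + \<rho>" m] \<rho> by simp
  also have "\<dots> \<le> real (Suc m) * (2 * \<rho>) * (2 * R) ^ m"
    using \<rho> by (intro mult_left_mono power_mono) auto
  finally have "\<rho> * (real (card X) * \<rho> ^ m) \<le> \<rho> * (2 * real (Suc m) * (2 * R) ^ m)"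
    by (simp add: algebra_simps)
  then show ?thesis using \<rho>(1) by (metis mult_le_cancel_left_pos)
qed

text \<open>A maximal \<open>2 * \<rho>\<close>-separated subset is a net of radius
  \<open>2 * \<rho>\<close>. It has at most a constant times \<open>\<rho> ^ - m\<close> points, so
  the cost of the cover by balls is bounded by a \<open>K\<close> independent of the scale.\<close>

lemma hausdorff_outer_sphere_finite:
  fixes p :: "'a::euclidean_space"
  assumes dim: "DIM('a) = Suc m" and R: "0 < R"
  shows "hausdorff_outer m (sphere p R) < top"
proof -
  define K where "K = unit_ball_vol (real m) * 2 ^ m * (2 * real (Suc m) * (2 * R) ^ m)"
  have small: "hausdorff_content m \<delta> (sphere p R) \<le> ennreal K" if \<delta>: "0 < \<delta>" "\<delta> \<le> 4 * R" for \<delta>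
  proof -
    \<comment> \<open>The covering balls have radius \<open>2 * \<rho>\<close>, hence diameter
      \<open>4 * \<rho> = \<delta>\<close>; the restriction \<open>\<delta> \<le> 4 * R\<close>
      gives the \<open>\<rho> \<le> R\<close> needed for packing.\<close>
    define \<rho> where "\<rho> = \<delta> / 4"
    have \<rho>: "0 < \<rho>" "\<rho> \<le> R" using \<delta> by (auto simp: \<rho>_def)
    let ?P = "\<lambda>X. finite X \<and> X \<subseteq> sphere p R \<and> (\<forall>x\<in>X. \<forall>y\<in>X. x \<noteq> y \<longrightarrow> 2 * \<rho> \<le> dist x y)"
    have card_le: "real (card X) * \<rho> ^ m \<le> 2 * real (Suc m) * (2 * R) ^ m" if "?P X" for X
      using that by (intro card_separated_sphere_le[OF dim \<rho>]) auto
    define b where "b = nat \<lceil>2 * real (Suc m) * (2 * R) ^ m / \<rho> ^ m\<rceil>"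
    have "card X < Suc b" if "?P X" for X
    proof -
      have "real (card X) \<le> 2 * real (Suc m) * (2 * R) ^ m / \<rho> ^ m"
        using card_le[OF that] \<rho> by (simp add: field_simps)
      then show ?thesis unfolding b_def by linarith
    qed
    then obtain X where X: "?P X" "\<And>Y. ?P Y \<Longrightarrow> card Y \<le> card X"
      using ex_has_greatest_nat[of ?P "{}" card "Suc b"] by auto
    have "sphere p R \<subseteq> (\<Union>x\<in>X. cball x (2 * \<rho>))"
    proof
      fix y assume y: "y \<in> sphere p R"
      show "y \<in> (\<Union>x\<in>X. cball x (2 * \<rho>))"
      proof (rule ccontr)
        assume "y \<notin> (\<Union>x\<in>X. cball x (2 * \<rho>))"
        then have far: "\<And>x. x \<in> X \<Longrightarrow> 2 * \<rho> < dist x y" by auto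
        then have "?P (insert y X)" using X(1) y
          by (auto simp: dist_commute intro: less_imp_le)
        moreover have "y \<notin> X" using far[of y] \<rho> by auto
        ultimately show False using X(2)[of "insert y X"] X(1) by simp
      qed
    qed
    then have "hausdorff_content m \<delta> (sphere p R) \<le> ennreal (real (card X) * (unit_ball_vol (real m) * (2 * \<rho>) ^ m))"
      using X(1) \<rho> by (intro hausdorff_content_le_card) (auto simp: \<rho>_def)
    also have "\<dots> \<le> ennreal K"
    proof (rule ennreal_leI)
      have "real (card X) * (unit_ball_vol (real m) * (2 * \<rho>) ^ m) = unit_ball_vol (real m) * 2 ^ m * (real (card X) * \<rho> ^ m)"
        by (simp add: power_mult_distrib)
      also have "\<dots> \<le> K" unfolding K_def by (intro mult_left_mono card_le[OF X(1)]) auto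
      finally show "real (card X) * (unit_ball_vol (real m) * (2 * \<rho>) ^ m) \<le> K" .
    qed
    finally show ?thesis .
  qed
  have "hausdorff_outer m (sphere p R) \<le> ennreal K"
    unfolding hausdorff_outer_def
  proof (rule SUP_least)
    fix \<delta> :: real assume "\<delta> \<in> {0<..}"
    then show "hausdorff_content m \<delta> (sphere p R) \<le> ennreal K"
      using small[of "min \<delta> (4 * R)"] hausdorff_content_antimono[of "min \<delta> (4 * R)" \<delta> m "sphere p R"] R
      by auto
  qed
  then show ?thesis by (meson ennreal_less_top le_less_trans)
qed

section \<open>Lower bounds from the volume of radial shells\<close>

definition radial_shell :: "'a::real_normed_vector \<Rightarrow> 'a set \<Rightarrow> 'a set" where
  "radial_shell p A = (\<lambda>(t, x). p + t *\<^sub>R (x - p)) ` ({1..2} \<times> A)"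

lemma compact_radial_shell: "compact A \<Longrightarrow> compact (radial_shell p A)"
  unfolding radial_shell_def split_def
  by (intro compact_continuous_image continuous_intros compact_Times) auto

text \<open>The shell over a set of diameter at most \<open>r\<close> is a tube of bounded length
  and thickness of order \<open>r\<close>. About \<open>1 / r\<close> balls of radius of order
  \<open>r\<close> cover it, each of volume of order \<open>r ^ Suc m\<close>, which leaves
  \<open>r ^ m\<close>.\<close>

lemma emeasure_radial_shell_le:
  fixes p :: "'a::euclidean_space"
  assumes dim: "DIM('a) = Suc m" and R: "0 < R" and C: "compact C" "x0 \<in> C" "dist x0 p = R"
    and r: "diameter C \<le> r" "0 < r" "r \<le> 2"
  shows "emeasure lborel (radial_shell p C)
    \<le> ennreal (5 * unit_ball_vol (real (Suc m)) * (2 + R) ^ Suc m * r ^ m)"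
proof -
  let ?\<omega> = "unit_ball_vol (real (Suc m))"
  define k where "k = nat \<lfloor>1 / r\<rfloor>"
  \<comment> \<open>Centres along the ray from \<open>p\<close> through \<open>x0\<close>, with
    scaling factors in steps of \<open>r\<close>. Rounding the factor costs at most
    \<open>r * R\<close>, and replacing \<open>x\<close> by \<open>x0\<close> at most
    \<open>2 * r\<close>; hence the radius \<open>r * (2 + R)\<close>.\<close>
  define z where "z j = p + (1 + real j * r) *\<^sub>R (x0 - p)" for j
  have k: "real k \<le> 1 / r" unfolding k_def using r by (simp add: of_nat_floor)
  have "radial_shell p C \<subseteq> (\<Union>j\<le>k. cball (z j) (r * (2 + R)))"
  proof
    fix y assume "y \<in> radial_shell p C"
    then obtain t x where t: "1 \<le> t" "t \<le> 2" and x: "x \<in> C" and y: "y = p + t *\<^sub>R (x - p)"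
      by (auto simp: radial_shell_def)
    define j where "j = nat \<lfloor>(t - 1) / r\<rfloor>"
    have nn: "0 \<le> (t - 1) / r" using t r by simp
    have "(t - 1) / r \<le> 1 / r" using t r by (simp add: divide_right_mono)
    then have jk: "j \<le> k" unfolding j_def k_def by (intro nat_mono floor_mono)
    have "real j \<le> (t - 1) / r" "(t - 1) / r < real j + 1" using nn unfolding j_def by linarith+
    then have "\<bar>1 + real j * r - t\<bar> \<le> r" using r by (auto simp: field_simps abs_le_iff)
    moreover have "norm (x0 - p) = R" using C(3) by (simp add: dist_norm)
    ultimately have "norm ((1 + real j * r - t) *\<^sub>R (x0 - p)) \<le> r * R"
      using R by (simp add: mult_right_mono)
    moreover have "norm (t *\<^sub>R (x0 - x)) \<le> 2 * r"
    proof -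
      have "dist x0 x \<le> r"
        using diameter_bounded_bound[OF compact_imp_bounded[OF C(1)] C(2) x] r by simp
      then show ?thesis using t r by (simp add: dist_norm mult_mono)
    qed
    moreover have "z j - y = (1 + real j * r - t) *\<^sub>R (x0 - p) + t *\<^sub>R (x0 - x)"
      by (simp add: z_def y algebra_simps)
    ultimately have "norm (z j - y) \<le> r * R + 2 * r"
      using norm_triangle_le by (metis add_mono)
    then have "y \<in> cball (z j) (r * (2 + R))" by (simp add: dist_norm algebra_simps)
    then show "y \<in> (\<Union>j\<le>k. cball (z j) (r * (2 + R)))" using jk by blast
  qed
  then have "emeasure lborel (radial_shell p C) \<le> emeasure lborel (\<Union>j\<le>k. cball (z j) (r * (2 + R)))"
    by (intro emeasure_mono) auto
  also have "\<dots> \<le> (\<Sum>j\<le>k. emeasure lborel (cball (z j) (r * (2 + R))))"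
    by (intro emeasure_subadditive_finite) auto
  also have "\<dots> = (\<Sum>j\<le>k. ennreal (?\<omega> * (r * (2 + R)) ^ Suc m))"
  proof (rule sum.cong)
    show "emeasure lborel (cball (z j) (r * (2 + R))) = ennreal (?\<omega> * (r * (2 + R)) ^ Suc m)" for j
      using emeasure_cball[of "r * (2 + R)" "z j"] r R by (simp only: dim) auto
  qed simp
  also have "\<dots> = ennreal (real (k + 1) * (?\<omega> * (r * (2 + R)) ^ Suc m))"
    using r R by (subst sum_ennreal) (auto intro!: mult_nonneg_nonneg)
  also have "\<dots> \<le> ennreal (5 * ?\<omega> * (2 + R) ^ Suc m * r ^ m)"
  proof (rule ennreal_leI)
    \<comment> \<open>From \<open>k * r \<le> 1\<close> and \<open>r \<le> 2\<close> the product is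
      at most 3; the constant 5 is generous.\<close>
    have "real (k + 1) * r \<le> 5" using k r by (simp add: field_simps)
    then have "(real (k + 1) * r) * (?\<omega> * (2 + R) ^ Suc m * r ^ m) \<le> 5 * (?\<omega> * (2 + R) ^ Suc m * r ^ m)"
      using r R by (intro mult_right_mono) auto
    then show "real (k + 1) * (?\<omega> * (r * (2 + R)) ^ Suc m) \<le> 5 * ?\<omega> * (2 + R) ^ Suc m * r ^ m"
      by (simp add: power_mult_distrib mult_ac)
  qed
  finally show ?thesis .
qed

text \<open>A covering set may be a single point, so the diameter itself is not an admissible
  \<open>r > 0\<close>; it is approached from above.\<close>

lemma emeasure_radial_shell_le_diameter:
  fixes p :: "'a::euclidean_space"
  assumes dim: "DIM('a) = Suc m" and R: "0 < R" and C: "compact C" "x0 \<in> C" "dist x0 p = R"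
    and d: "diameter C \<le> 1"
  shows "emeasure lborel (radial_shell p C)
    \<le> ennreal (5 * unit_ball_vol (real (Suc m)) * (2 + R) ^ Suc m * diameter C ^ m)"
proof (rule LIMSEQ_le_const)
  have "(\<lambda>k. 1 / real (Suc k)) \<longlonglongrightarrow> 0" by (rule LIMSEQ_Suc[OF lim_1_over_n])
  then have "(\<lambda>k. diameter C + 1 / real (Suc k)) \<longlonglongrightarrow> diameter C + 0"
    by (intro tendsto_intros)
  then show "(\<lambda>k. ennreal (5 * unit_ball_vol (real (Suc m)) * (2 + R) ^ Suc m * (diameter C + 1 / real (Suc k)) ^ m))
      \<longlonglongrightarrow> ennreal (5 * unit_ball_vol (real (Suc m)) * (2 + R) ^ Suc m * diameter C ^ m)"
    by (intro tendsto_ennrealI tendsto_mult_left tendsto_power) simp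
  have "emeasure lborel (radial_shell p C)
      \<le> ennreal (5 * unit_ball_vol (real (Suc m)) * (2 + R) ^ Suc m * (diameter C + 1 / real (Suc k)) ^ m)" for k
  proof (rule emeasure_radial_shell_le[OF dim R C])
    have "0 \<le> diameter C" using C(1) by (intro diameter_ge_0 compact_imp_bounded)
    moreover have "0 < 1 / real (Suc k)" "1 / real (Suc k) \<le> 1" by auto
    ultimately show "diameter C \<le> diameter C + 1 / real (Suc k)" "0 < diameter C + 1 / real (Suc k)"
      "diameter C + 1 / real (Suc k) \<le> 2"
      using d by linarith+
  qed
  then show "\<exists>N. \<forall>k\<ge>N. emeasure lborel (radial_shell p C)
      \<le> ennreal (5 * unit_ball_vol (real (Suc m)) * (2 + R) ^ Suc m * (diameter C + 1 / real (Suc k)) ^ m)"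
    by blast
qed

text \<open>
  A cover of \<open>A\<close> induces a cover of the radial shell over \<open>A\<close> by sets whose Lebesgue measures are
  bounded by the covering costs.
\<close>
lemma hausdorff_outer_pos:
  fixes p :: "'a::euclidean_space"
  assumes dim: "DIM('a) = Suc m" and R: "0 < R" and A: "A \<subseteq> sphere p R"
    and V: "open V" "V \<noteq> {}" "V \<subseteq> radial_shell p A"
  shows "0 < hausdorff_outer m A"
proof -
  define K where "K = 5 * unit_ball_vol (real (Suc m)) * (2 + R) ^ Suc m"
  have "0 < K" unfolding K_def using R by (intro mult_pos_pos) auto
  \<comment> \<open>Chosen so that \<kappa> times the volume bound for a shell is exactly the cost
    of the covering set below it.\<close>
  define \<kappa> where "\<kappa> = unit_ball_vol (real m) / (2 ^ m * K)"
  have "0 < \<kappa>" using \<open>0 < K\<close> by (simp add: \<kappa>_def)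
  \<comment> \<open>A single scale suffices, since every content bounds the outer measure from
    below; scale 1 provides the diameter bound required by the volume estimate.\<close>
  have "ennreal \<kappa> * emeasure lborel V \<le> hausdorff_content m 1 A"
    unfolding hausdorff_content_eq
  proof (rule INF_greatest)
    fix C :: "nat \<Rightarrow> 'a set"
    assume "C \<in> {C. A \<subseteq> (\<Union>i. C i) \<and> (\<forall>i. bounded (C i) \<and> diameter (C i) \<le> 1)}"
    then have C: "A \<subseteq> (\<Union>i. C i)" "\<And>i. bounded (C i)" "\<And>i. diameter (C i) \<le> 1" by auto
    \<comment> \<open>Sets missing \<open>A\<close> are dropped because the estimate needs a point
      of the sphere in the set. Closures are taken to get compact, hence measurable, shells at the
      same diameter.\<close>
    define D where "D i = (if A \<inter> C i = {} then {} else radial_shell p (closure (C i)))" for i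
    have cpt: "compact (closure (C i))" for i using C(2) by (simp add: compact_closure)
    then have D_sets: "D i \<in> sets lborel" for i
      using borel_compact[OF compact_radial_shell[OF cpt[of i], of p]] by (simp add: D_def)
    have "V \<subseteq> (\<Union>i. D i)"
    proof
      fix y assume "y \<in> V"
      then obtain t x where "t \<in> {1..2}" "x \<in> A" "y = p + t *\<^sub>R (x - p)"
        using V(3) by (auto simp: radial_shell_def)
      moreover obtain i where "x \<in> C i" using C(1) \<open>x \<in> A\<close> by blast
      ultimately have "y \<in> D i"
        using closure_subset[of "C i"] by (auto simp: D_def radial_shell_def)
      then show "y \<in> (\<Union>i. D i)" by blast
    qed
    then have "emeasure lborel V \<le> emeasure lborel (\<Union>i. D i)"
      using D_sets by (intro emeasure_mono) auto
    also have "\<dots> \<le> (\<Sum>i. emeasure lborel (D i))"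
      using D_sets by (intro emeasure_subadditive_countably) auto
    finally have "ennreal \<kappa> * emeasure lborel V \<le> (\<Sum>i. ennreal \<kappa> * emeasure lborel (D i))"
      by (simp add: mult_left_mono)
    also have "\<dots> \<le> (\<Sum>i. covering_cost m (C i))"
    proof (intro suminf_le summableI)
      fix i
      show "ennreal \<kappa> * emeasure lborel (D i) \<le> covering_cost m (C i)"
      proof (cases "A \<inter> C i = {}")
        case False
        then obtain x0 where x0: "x0 \<in> A" "x0 \<in> C i" by auto
        have "emeasure lborel (radial_shell p (closure (C i))) \<le> ennreal (K * diameter (closure (C i)) ^ m)"
          unfolding K_def
          using x0 A C closure_subset[of "C i"] cpt
          by (intro emeasure_radial_shell_le_diameter[OF dim R, of _ x0])
             (auto simp: dist_commute diameter_closure)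
        then have "ennreal \<kappa> * emeasure lborel (D i) \<le> ennreal \<kappa> * ennreal (K * diameter (C i) ^ m)"
          using False C(2) by (auto simp: D_def diameter_closure intro: mult_left_mono)
        also have "\<dots> = ennreal (\<kappa> * (K * diameter (C i) ^ m))"
          using \<open>0 < K\<close> \<open>0 < \<kappa>\<close> C(2) by (intro ennreal_mult[symmetric]) (auto simp: diameter_ge_0)
        also have "\<kappa> * (K * diameter (C i) ^ m) = unit_ball_vol (real m) * (diameter (C i) / 2) ^ m"
          using \<open>0 < K\<close> by (simp add: \<kappa>_def power_divide)
        also have "ennreal \<dots> = covering_cost m (C i)" using x0 by (auto simp: covering_cost_def)
        finally show ?thesis .
      qed (simp add: D_def)
    qed
    finally show "ennreal \<kappa> * emeasure lborel V \<le> (\<Sum>i. covering_cost m (C i))" .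
  qed
  moreover have "emeasure lborel V \<noteq> 0"
  proof -
    obtain x e where "0 < e" "ball x e \<subseteq> V"
      using V(1,2) by (meson ex_in_conv open_contains_ball)
    moreover have "0 < emeasure lborel (ball x e)"
      using \<open>0 < e\<close> by (simp add: emeasure_ball)
    ultimately show ?thesis
      using V(1) emeasure_mono[of "ball x e" V lborel] by (auto simp: less_le_not_le)
  qed
  then have "0 < ennreal \<kappa> * emeasure lborel V"
    using \<open>0 < \<kappa>\<close> by (simp add: zero_less_iff_neq_zero)
  ultimately have "0 < hausdorff_content m 1 A" by (rule less_le_trans[rotated])
  also have "\<dots> \<le> hausdorff_outer m A" by (rule hausdorff_content_le_outer) simp
  finally show ?thesis .
qed

section \<open>Jordan decomposition of signed measures\<close>

lemma finite_signed_measure_empty: "finite_signed_measure M \<nu> \<Longrightarrow> \<nu> {} = 0"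
  by (simp add: finite_signed_measure_def)

lemma finite_signed_measure_sums:
  "finite_signed_measure M \<nu> \<Longrightarrow> range A \<subseteq> sets M \<Longrightarrow> disjoint_family A \<Longrightarrow>
    (\<lambda>i. \<nu> (A i)) sums \<nu> (\<Union>i. A i)"
  by (simp add: finite_signed_measure_def)

lemma finite_signed_measure_Un:
  assumes "finite_signed_measure M \<nu>" "A \<in> sets M" "B \<in> sets M" "A \<inter> B = {}"
  shows "\<nu> (A \<union> B) = \<nu> A + \<nu> B"
proof -
  have "(\<lambda>i. \<nu> (binaryset A B i)) sums \<nu> (\<Union>i. binaryset A B i)"
    using assms
    by (intro finite_signed_measure_sums)
       (auto simp: range_binaryset_eq disjoint_family_on_def binaryset_def)
  moreover have "(\<lambda>i. \<nu> (binaryset A B i)) sums (\<nu> A + \<nu> B)"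
    by (rule binaryset_sums) (rule finite_signed_measure_empty[OF assms(1)])
  ultimately show ?thesis by (metis UN_binaryset_eq sums_unique2)
qed

lemma finite_signed_measure_Diff:
  assumes "finite_signed_measure M \<nu>" "A \<in> sets M" "B \<in> sets M" "B \<subseteq> A"
  shows "\<nu> (A - B) = \<nu> A - \<nu> B"
  using finite_signed_measure_Un[of M \<nu> B "A - B"] assms by (simp add: Un_absorb1)

lemma finite_signed_measure_uminus:
  "finite_signed_measure M \<nu> \<Longrightarrow> finite_signed_measure M (\<lambda>A. - \<nu> A)"
  by (simp add: finite_signed_measure_def sums_minus)

lemma finite_signed_measure_diff_measure:
  assumes "finite_signed_measure M \<nu>" "finite_measure \<sigma>" "sets \<sigma> = sets M"
  shows "finite_signed_measure M (\<lambda>A. \<nu> A - measure \<sigma> A)"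
  using assms finite_measure.finite_measure_UNION[of \<sigma>]
  by (simp add: finite_signed_measure_def sums_diff)

section \<open>The positive variation is a finite measure\<close>

definition positive_variation :: "'a measure \<Rightarrow> ('a set \<Rightarrow> real) \<Rightarrow> 'a set \<Rightarrow> ennreal" where
  "positive_variation M \<nu> A = (SUP B\<in>{B \<in> sets M. B \<subseteq> A}. ennreal (\<nu> B))"

lemma positive_variation_upper:
  "B \<in> sets M \<Longrightarrow> B \<subseteq> A \<Longrightarrow> ennreal (\<nu> B) \<le> positive_variation M \<nu> A"
  unfolding positive_variation_def by (rule SUP_upper) auto

lemma positive_variation_mono: "A \<subseteq> B \<Longrightarrow> positive_variation M \<nu> A \<le> positive_variation M \<nu> B"
  unfolding positive_variation_def by (rule SUP_subset_mono) auto

lemma ennreal_SUP_add_le: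
  fixes c :: ennreal
  assumes "I \<noteq> {}" "J \<noteq> {}" "\<And>i j. i \<in> I \<Longrightarrow> j \<in> J \<Longrightarrow> f i + g j \<le> c"
  shows "(SUP i\<in>I. f i) + (SUP j\<in>J. g j) \<le> c"
proof -
  have "f i + (SUP j\<in>J. g j) \<le> c" if "i \<in> I" for i
    unfolding ennreal_SUP_add_right[OF assms(2)] by (rule SUP_least) (rule assms(3)[OF that])
  then show ?thesis
    unfolding ennreal_SUP_add_left[OF assms(1), symmetric] by (rule SUP_least)
qed

lemma positive_variation_Un:
  assumes \<nu>: "finite_signed_measure M \<nu>" and "A \<inter> B = {}"
  shows "positive_variation M \<nu> A + positive_variation M \<nu> B \<le> positive_variation M \<nu> (A \<union> B)"
proof -
  have "ennreal (\<nu> C) + ennreal (\<nu> D) \<le> positive_variation M \<nu> (A \<union> B)"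
    if "C \<in> sets M" "C \<subseteq> A" "D \<in> sets M" "D \<subseteq> B" for C D
  proof (cases "0 \<le> \<nu> C \<and> 0 \<le> \<nu> D")
    case True
    moreover have "C \<inter> D = {}" using that assms(2) by blast
    ultimately have "ennreal (\<nu> C) + ennreal (\<nu> D) = ennreal (\<nu> (C \<union> D))"
      using finite_signed_measure_Un[OF \<nu>, of C D] that by simp
    also have "\<dots> \<le> positive_variation M \<nu> (A \<union> B)"
      using that by (intro positive_variation_upper) auto
    finally show ?thesis .
  next
    case False
    \<comment> \<open>A negative value is truncated to 0, and the other set alone competes in the
      supremum for the union.\<close>
    then have "ennreal (\<nu> C) = 0 \<or> ennreal (\<nu> D) = 0" by (auto simp: ennreal_neg)
    moreover have "ennreal (\<nu> C) \<le> positive_variation M \<nu> (A \<union> B)"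
      "ennreal (\<nu> D) \<le> positive_variation M \<nu> (A \<union> B)"
      using that by (auto intro!: positive_variation_upper)
    ultimately show ?thesis by auto
  qed
  then show ?thesis
    unfolding positive_variation_def[of M \<nu> A] positive_variation_def[of M \<nu> B]
    by (intro ennreal_SUP_add_le) auto
qed

lemma positive_variation_empty:
  "finite_signed_measure M \<nu> \<Longrightarrow> positive_variation M \<nu> {} = 0"
  by (auto simp: positive_variation_def finite_signed_measure_empty intro!: SUP_eqI)

lemma ennreal_sum_le: "ennreal (sum f I) \<le> (\<Sum>i\<in>I. ennreal (f i))"
proof -
  have "ennreal (sum f I) \<le> ennreal (\<Sum>i\<in>I. max 0 (f i))"
    by (intro ennreal_leI sum_mono) auto
  also have "\<dots> = (\<Sum>i\<in>I. ennreal (max 0 (f i)))" by (rule sum_ennreal[symmetric]) auto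
  also have "\<dots> = (\<Sum>i\<in>I. ennreal (f i))" by (intro sum.cong) (auto simp: max_def ennreal_neg)
  finally show ?thesis .
qed

text \<open>Superadditivity on disjoint sets together with monotonicity gives one inequality. For
  the other, a competitor \<open>B\<close> for the union is cut into the pieces
  \<open>B \<inter> A i\<close>.\<close>

lemma countably_additive_positive_variation:
  assumes \<nu>: "finite_signed_measure M \<nu>"
  shows "countably_additive (sets M) (positive_variation M \<nu>)"
proof (rule countably_additiveI)
  fix A :: "nat \<Rightarrow> 'a set"
  assume A: "range A \<subseteq> sets M" "disjoint_family A"
  let ?p = "positive_variation M \<nu>"
  show "(\<Sum>i. ?p (A i)) = ?p (\<Union>i. A i)"
  proof (rule antisym)
    have "(\<Sum>i<n. ?p (A i)) \<le> ?p (\<Union>i<n. A i)" for n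
    proof (induction n)
      case (Suc n)
      have "A n \<inter> A i = {}" if "i < n" for i
        using that by (intro disjoint_family_onD[OF A(2)]) auto
      then have "A n \<inter> (\<Union>i<n. A i) = {}" by blast
      then have "?p (A n) + ?p (\<Union>i<n. A i) \<le> ?p (\<Union>i<Suc n. A i)"
        using positive_variation_Un[OF \<nu>] by (simp add: lessThan_Suc)
      then show ?case using add_left_mono[OF Suc.IH, of "?p (A n)"]
        by (metis (no_types, lifting) add.commute order.trans sum.lessThan_Suc)
    qed (simp add: positive_variation_empty[OF \<nu>])
    moreover have "?p (\<Union>i<n. A i) \<le> ?p (\<Union>i. A i)" for n
      by (rule positive_variation_mono) auto
    ultimately show "(\<Sum>i. ?p (A i)) \<le> ?p (\<Union>i. A i)"
      by (intro suminf_le_const summableI) (rule order.trans)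
  next
    show "?p (\<Union>i. A i) \<le> (\<Sum>i. ?p (A i))"
      unfolding positive_variation_def[of M \<nu> "\<Union>i. A i"]
    proof (rule SUP_least)
      fix B assume B: "B \<in> {B \<in> sets M. B \<subseteq> (\<Union>i. A i)}"
      have "(\<lambda>i. \<nu> (B \<inter> A i)) sums \<nu> (\<Union>i. B \<inter> A i)"
        using A B by (intro finite_signed_measure_sums[OF \<nu>]) (auto simp: disjoint_family_on_def)
      moreover have "(\<Union>i. B \<inter> A i) = B" using B by auto
      ultimately have "(\<lambda>n. ennreal (\<Sum>i<n. \<nu> (B \<inter> A i))) \<longlonglongrightarrow> ennreal (\<nu> B)"
        by (auto simp: sums_def intro!: tendsto_ennrealI)
      moreover have "ennreal (\<Sum>i<n. \<nu> (B \<inter> A i)) \<le> (\<Sum>i. ?p (A i))" for n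
      proof -
        have "ennreal (\<Sum>i<n. \<nu> (B \<inter> A i)) \<le> (\<Sum>i<n. ennreal (\<nu> (B \<inter> A i)))"
          by (rule ennreal_sum_le)
        also have "\<dots> \<le> (\<Sum>i<n. ?p (A i))"
          using A B by (intro sum_mono positive_variation_upper) auto
        also have "\<dots> \<le> (\<Sum>i. ?p (A i))" by (rule sum_le_suminf) auto
        finally show ?thesis .
      qed
      ultimately show "ennreal (\<nu> B) \<le> (\<Sum>i. ?p (A i))"
        by (intro LIMSEQ_le_const2) auto
    qed
  qed
qed

lemma space_positive_part [simp]: "space (positive_part M \<nu>) = space M"
  by (simp add: positive_part_def sets.space_closed)

lemma sets_positive_part [simp, measurable_cong]: "sets (positive_part M \<nu>) = sets M"
  by (simp add: positive_part_def sets.sets_measure_of_eq)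

lemma emeasure_positive_part:
  assumes \<nu>: "finite_signed_measure M \<nu>" and A: "A \<in> sets M"
  shows "emeasure (positive_part M \<nu>) A = positive_variation M \<nu> A"
  unfolding positive_part_def positive_variation_def[symmetric]
  by (rule emeasure_measure_of_sigma)
     (auto simp: A positive_def sets.sigma_algebra_axioms positive_variation_empty[OF \<nu>]
       countably_additive_positive_variation[OF \<nu>])

text \<open>
  If the positive variation of \<open>E\<close> is infinite, a piece with \<open>\<bar>\<nu>\<bar> \<ge> 1\<close> can be split off such that
  the rest still has infinite positive variation. Iterating produces disjoint sets whose measures
  do not tend to zero.
\<close>
lemma finite_measure_positive_part:
  assumes \<nu>: "finite_signed_measure M \<nu>"
  shows "finite_measure (positive_part M \<nu>)"
proof (rule finite_measureI, rule notI)
  let ?p = "positive_variation M \<nu>"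
  assume "emeasure (positive_part M \<nu>) (space (positive_part M \<nu>)) = \<infinity>"
  then have top: "?p (space M) = top" by (simp add: emeasure_positive_part[OF \<nu>])
  have step: "\<exists>F. F \<in> sets M \<and> ?p F = top \<and> F \<subseteq> E \<and> 1 \<le> \<bar>\<nu> (E - F)\<bar>"
    if E: "E \<in> sets M" "?p E = top" for E
  proof -
    \<comment> \<open>With \<open>\<nu> B\<close> above \<open>1 + \<bar>\<nu> E\<bar>\<close>, both
      \<open>B\<close> and \<open>E - B\<close> have measure of absolute value at least 1. Either
      may be split off, so the rest can be the one whose variation is infinite.\<close>
    have "ennreal (1 + \<bar>\<nu> E\<bar>) < ?p E" using E(2) by simp
    then obtain B where B: "B \<in> sets M" "B \<subseteq> E" "ennreal (1 + \<bar>\<nu> E\<bar>) < ennreal (\<nu> B)"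
      unfolding positive_variation_def less_SUP_iff by auto
    then have big: "1 + \<bar>\<nu> E\<bar> < \<nu> B"
      by (metis abs_ge_zero add_nonneg_nonneg ennreal_less_iff zero_le_one)
    have diff: "\<nu> (E - B) = \<nu> E - \<nu> B"
      using finite_signed_measure_Diff[OF \<nu>] E B by simp
    have "?p B + ?p (E - B) = top"
    proof -
      have "emeasure (positive_part M \<nu>) (B \<union> (E - B)) = top"
        using E B by (simp add: emeasure_positive_part[OF \<nu>] Un_absorb1)
      then show ?thesis
        using E B by (subst (asm) plus_emeasure[symmetric]) (auto simp: emeasure_positive_part[OF \<nu>])
    qed
    then consider "?p B = top" | "?p (E - B) = top" by auto
    then show ?thesis
    proof cases
      case 1
      then show ?thesis using B big diff by (intro exI[of _ B]) auto
    next
      case 2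
      moreover have "E - (E - B) = B" using B by auto
      ultimately show ?thesis using B E big by (intro exI[of _ "E - B"]) auto
    qed
  qed
  obtain E where E: "\<And>n. E n \<in> sets M \<and> ?p (E n) = top"
    "\<And>n. E (Suc n) \<subseteq> E n \<and> 1 \<le> \<bar>\<nu> (E n - E (Suc n))\<bar>"
    using dependent_nat_choice[of "\<lambda>_ E. E \<in> sets M \<and> ?p E = top" "\<lambda>_ E F. F \<subseteq> E \<and> 1 \<le> \<bar>\<nu> (E - F)\<bar>"]
      top step by (metis sets.top)
  have "decseq E" using E(2) by (intro decseq_SucI) auto
  have "disjoint_family (\<lambda>n. E n - E (Suc n))"
    unfolding disjoint_family_on_def
  proof (intro ballI impI)
    fix m n :: nat assume "m \<noteq> n"
    then consider "Suc m \<le> n" | "Suc n \<le> m" by linarith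
    then show "(E m - E (Suc m)) \<inter> (E n - E (Suc n)) = {}"
      using \<open>decseq E\<close> by cases (auto dest: decseqD)
  qed
  then have "(\<lambda>n. \<nu> (E n - E (Suc n))) sums \<nu> (\<Union>n. E n - E (Suc n))"
    using E(1) by (intro finite_signed_measure_sums[OF \<nu>]) auto
  then have "(\<lambda>n. \<nu> (E n - E (Suc n))) \<longlonglongrightarrow> 0"
    by (meson sums_summable summable_LIMSEQ_zero)
  then have "\<forall>\<^sub>F n in sequentially. \<bar>\<nu> (E n - E (Suc n))\<bar> < 1"
    by (auto dest: tendstoD[where e=1])
  then obtain n where "\<bar>\<nu> (E n - E (Suc n))\<bar> < 1"
    using eventually_happens'[OF sequentially_bot] by blast
  then show False using E(2)[of n] by simp
qed

section \<open>The Jordan decomposition and integrals of bounded functions\<close>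

lemma measure_positive_part_le:
  assumes \<nu>: "finite_signed_measure M \<nu>" and A: "A \<in> sets M"
    and le: "\<And>B. B \<in> sets M \<Longrightarrow> B \<subseteq> A \<Longrightarrow> \<nu> B \<le> c"
  shows "measure (positive_part M \<nu>) A \<le> c"
proof -
  have "0 \<le> c" using le[of "{}"] finite_signed_measure_empty[OF \<nu>] by simp
  moreover have "emeasure (positive_part M \<nu>) A \<le> ennreal c"
    unfolding emeasure_positive_part[OF \<nu> A] positive_variation_def
    by (rule SUP_least) (auto intro: ennreal_leI le)
  ultimately show ?thesis by (simp add: measure_def enn2real_leI)
qed

lemma le_measure_positive_part:
  assumes \<nu>: "finite_signed_measure M \<nu>" and "A \<in> sets M" "B \<in> sets M" "B \<subseteq> A"
  shows "\<nu> B \<le> measure (positive_part M \<nu>) A"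
  using positive_variation_upper[of B M A \<nu>] assms emeasure_positive_part[OF \<nu>, of A]
    finite_measure.emeasure_eq_measure[OF finite_measure_positive_part[OF \<nu>], of A]
  by (metis ennreal_le_iff measure_nonneg)

text \<open>Complementation in \<open>A\<close>: a large value on \<open>B\<close> means a small
  value on \<open>A - B\<close>. Taking the supremum over \<open>B\<close> gives one inequality, and
  the same argument for \<open>- \<nu>\<close> the other.\<close>

lemma jordan_decomposition:
  assumes \<nu>: "finite_signed_measure M \<nu>" and A: "A \<in> sets M"
  shows "\<nu> A = measure (positive_part M \<nu>) A - measure (positive_part M (\<lambda>A. - \<nu> A)) A"
proof -
  have *: "measure (positive_part M \<kappa>) A \<le> \<kappa> A + measure (positive_part M (\<lambda>A. - \<kappa> A)) A"
    if \<kappa>: "finite_signed_measure M \<kappa>" for \<kappa>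
  proof (rule measure_positive_part_le[OF \<kappa> A])
    fix B assume B: "B \<in> sets M" "B \<subseteq> A"
    then show "\<kappa> B \<le> \<kappa> A + measure (positive_part M (\<lambda>A. - \<kappa> A)) A"
      using le_measure_positive_part[OF finite_signed_measure_uminus[OF \<kappa>] A, of "A - B"]
        finite_signed_measure_Diff[OF \<kappa> A B] A by simp
  qed
  show ?thesis
    using *[OF \<nu>] *[OF finite_signed_measure_uminus[OF \<nu>]] by simp
qed

text \<open>The Jordan parts of a difference are not the differences of the parts; what holds is a
  linear relation among all the measures involved. This lemma carries such a relation over to
  integrals.\<close>

lemma sum_integral_eq_zero:
  fixes f :: "'a \<Rightarrow> real"
  assumes fin: "\<And>i. i \<in> I \<Longrightarrow> finite_measure (N i)" and sets: "\<And>i. i \<in> I \<Longrightarrow> sets (N i) = sets M"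
    and zero: "\<And>A. A \<in> sets M \<Longrightarrow> (\<Sum>i\<in>I. c i * measure (N i) A) = 0"
    and f: "f \<in> borel_measurable M" and bound: "\<And>x. x \<in> space M \<Longrightarrow> \<bar>f x\<bar> \<le> B"
  shows "(\<Sum>i\<in>I. c i * (\<integral>x. f x \<partial>N i)) = 0"
proof -
  have space: "space (N i) = space M" if "i \<in> I" for i
    using sets[OF that] by (rule sets_eq_imp_space_eq)
  have meas: "g \<in> borel_measurable (N i)" if "g \<in> borel_measurable M" "i \<in> I" for g :: "'a \<Rightarrow> real" and i
    using that(1) measurable_cong_sets[OF sets[OF that(2)] refl] by blast
  have int: "integrable (N i) g"
    if "g \<in> borel_measurable M" "\<And>x. x \<in> space M \<Longrightarrow> 0 \<le> g x \<and> g x \<le> b" "i \<in> I" for g :: "'a \<Rightarrow> real" and b i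
    by (rule finite_measure.integrable_const_bound[OF fin[OF that(3)], where B=b])
       (use that(2) meas[OF that(1,3)] in \<open>auto intro!: AE_I2 simp: space[OF that(3)]\<close>)
  \<comment> \<open>Induction over nonnegative functions keeps an upper bound \<open>b\<close>
    throughout, for integrability in the sum and for dominated convergence in the limit;
    \<open>b\<close> must vary because scaling by \<open>k\<close> turns it into
    \<open>b / k\<close>.\<close>
  have nonneg: "(\<Sum>i\<in>I. c i * (\<integral>x. g x \<partial>N i)) = 0"
    if g: "g \<in> borel_measurable M" "\<And>x. 0 \<le> g x" and b: "\<And>x. x \<in> space M \<Longrightarrow> g x \<le> b"
    for g :: "'a \<Rightarrow> real" and b
    using g b
  proof (induction arbitrary: b rule: borel_measurable_induct_real)
    case (set A)
    have "(\<integral>x. indicator A x \<partial>N i) = measure (N i) A" if "i \<in> I" for i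
      using that set sets space by (simp add: sets.Int_space_eq2)
    then show ?case using zero[OF set(1)] by simp
  next
    case (mult u k)
    have u: "u x \<le> b / k" if "0 < k" "x \<in> space M" for x
      using mult.prems[OF that(2)] that(1) by (simp add: field_simps)
    have "(\<Sum>i\<in>I. c i * (\<integral>x. k * u x \<partial>N i)) = k * (\<Sum>i\<in>I. c i * (\<integral>x. u x \<partial>N i))"
      by (simp add: sum_distrib_left mult_ac)
    then show ?case using mult.IH[of "b / k"] u mult.hyps by (cases "k = 0") auto
  next
    case (add u v)
    have le: "u x \<le> b" "v x \<le> b" if "x \<in> space M" for x
      using add.prems[OF that] add.hyps(2)[of x] add.hyps(4)[of x] by auto
    have "(\<Sum>i\<in>I. c i * (\<integral>x. v x + u x \<partial>N i))
        = (\<Sum>i\<in>I. c i * (\<integral>x. v x \<partial>N i)) + (\<Sum>i\<in>I. c i * (\<integral>x. u x \<partial>N i))"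
      using int[of u b] int[of v b] add.hyps le
      by (simp add: Bochner_Integration.integral_add algebra_simps sum.distrib)
    then show ?case using add.IH(1)[of b] add.IH(2)[of b] le by (simp add: add.commute)
  next
    case (seq U)
    have Ule: "U k x \<le> g x" if "x \<in> space M" for k x
      using seq.hyps(3) seq.hyps(4)[OF that] by (intro incseq_le[of "\<lambda>k. U k x"]) (auto simp: incseq_def le_fun_def)
    then have Ub: "U k x \<le> b" if "x \<in> space M" for k x
      using seq.prems that order.trans by blast
    have "(\<lambda>k. \<integral>x. U k x \<partial>N i) \<longlonglongrightarrow> (\<integral>x. g x \<partial>N i)" if "i \<in> I" for i
    proof (rule integral_dominated_convergence[where w="\<lambda>_. b"])
      show "integrable (N i) (\<lambda>_. b)" by (rule finite_measure.integrable_const[OF fin[OF that]])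
      show "g \<in> borel_measurable (N i)" by (rule meas[OF g(1) that])
      show "U k \<in> borel_measurable (N i)" for k by (rule meas[OF seq.hyps(1) that])
      show "AE x in N i. (\<lambda>k. U k x) \<longlonglongrightarrow> g x"
        using seq.hyps(4) by (intro AE_I2) (simp add: space[OF that])
      show "AE x in N i. norm (U k x) \<le> b" for k
        using seq.hyps(2) Ub by (intro AE_I2) (simp add: space[OF that])
    qed
    then have "(\<lambda>k. \<Sum>i\<in>I. c i * (\<integral>x. U k x \<partial>N i)) \<longlonglongrightarrow> (\<Sum>i\<in>I. c i * (\<integral>x. g x \<partial>N i))"
      by (intro tendsto_sum tendsto_mult_left)
    moreover have "(\<Sum>i\<in>I. c i * (\<integral>x. U k x \<partial>N i)) = 0" for k
      using Ub by (rule seq.IH)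
    ultimately show ?case by (simp add: LIMSEQ_const_iff)
  qed
  \<comment> \<open>The shift by \<open>B\<close> makes \<open>f\<close> nonnegative on
    \<open>space M\<close>; \<open>max 0\<close> makes it so everywhere, as \<open>nonneg\<close>
    demands. The constant drops out by the relation at \<open>A = space M\<close>.\<close>
  have shift: "(\<integral>x. max 0 (f x + B) \<partial>N i) = (\<integral>x. f x \<partial>N i) + (\<integral>x. B \<partial>N i)" if "i \<in> I" for i
  proof -
    have "integrable (N i) f"
      by (rule finite_measure.integrable_const_bound[OF fin[OF that], where B=B])
         (use bound meas[OF f that] in \<open>auto intro!: AE_I2 simp: space[OF that]\<close>)
    moreover have "(\<integral>x. max 0 (f x + B) \<partial>N i) = (\<integral>x. f x + B \<partial>N i)"
    proof (intro Bochner_Integration.integral_cong refl)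
      fix x assume "x \<in> space (N i)"
      then show "max 0 (f x + B) = f x + B" using bound[of x] space[OF that] by auto
    qed
    ultimately show ?thesis
      using finite_measure.integrable_const[OF fin[OF that], of B] by simp
  qed
  have "(\<Sum>i\<in>I. c i * (\<integral>x. max 0 (f x + B) \<partial>N i))
      = (\<Sum>i\<in>I. c i * (\<integral>x. f x \<partial>N i)) + (\<Sum>i\<in>I. c i * (\<integral>x. B \<partial>N i))"
    by (simp add: shift distrib_left sum.distrib)
  moreover have "(\<Sum>i\<in>I. c i * (\<integral>x. max 0 (f x + B) \<partial>N i)) = 0"
  proof (rule nonneg[where b="2 * B"])
    fix x assume "x \<in> space M"
    then show "max 0 (f x + B) \<le> 2 * B" using bound[of x] by auto
  qed (use f in auto)
  moreover have "(\<Sum>i\<in>I. c i * (\<integral>x. B \<partial>N i)) = B * (\<Sum>i\<in>I. c i * measure (N i) (space M))"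
    using space by (simp add: sum_distrib_left mult_ac)
  ultimately show ?thesis
    using zero[OF sets.top] by simp
qed

lemma signed_integral_diff_measure:
  fixes f :: "'a \<Rightarrow> real"
  assumes \<nu>: "finite_signed_measure M \<nu>" and \<sigma>: "finite_measure \<sigma>" "sets \<sigma> = sets M"
    and f: "f \<in> borel_measurable M" "\<And>x. x \<in> space M \<Longrightarrow> \<bar>f x\<bar> \<le> B"
  shows "signed_integral M (\<lambda>A. \<nu> A - measure \<sigma> A) f = signed_integral M \<nu> f - (\<integral>x. f x \<partial>\<sigma>)"
proof -
  let ?\<kappa> = "\<lambda>A. \<nu> A - measure \<sigma> A"
  have \<kappa>: "finite_signed_measure M ?\<kappa>"
    by (rule finite_signed_measure_diff_measure[OF \<nu> \<sigma>])
  \<comment> \<open>With \<kappa> the difference, the relation is: positive minus negative part of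
    \<kappa>, minus positive plus negative part of \<nu>, plus \<sigma>, equals 0.\<close>
  define N where "N i = (if i = 0 then positive_part M ?\<kappa>
    else if i = 1 then positive_part M (\<lambda>A. - ?\<kappa> A)
    else if i = 2 then positive_part M \<nu>
    else if i = 3 then positive_part M (\<lambda>A. - \<nu> A) else \<sigma>)" for i :: nat
  define c where "c i = (if i = 1 \<or> i = 2 then -1 else 1 :: real)" for i :: nat
  have "(\<Sum>i\<in>{0, 1, 2, 3, 4}. c i * (\<integral>x. f x \<partial>N i)) = 0"
  proof (rule sum_integral_eq_zero[OF _ _ _ f])
    show "finite_measure (N i)" for i
      using \<sigma>(1) finite_measure_positive_part[OF \<nu>] finite_measure_positive_part[OF \<kappa>]
        finite_measure_positive_part[OF finite_signed_measure_uminus[OF \<nu>]]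
        finite_measure_positive_part[OF finite_signed_measure_uminus[OF \<kappa>]]
      by (simp add: N_def)
    show "sets (N i) = sets M" for i
      using \<sigma>(2) by (simp add: N_def)
    show "(\<Sum>i\<in>{0, 1, 2, 3, 4}. c i * measure (N i) A) = 0" if "A \<in> sets M" for A
      using jordan_decomposition[OF \<nu> that] jordan_decomposition[OF \<kappa> that]
      by (simp add: N_def c_def)
  qed
  then show ?thesis
    by (simp add: N_def c_def signed_integral_def)
qed

section \<open>Surface area measure of a lens\<close>

lemma outer_unit_normal_of_cball:
  assumes "K \<subseteq> cball p R" "dist x p = R" "0 < R"
  shows "(1 / R) *\<^sub>R (x - p) \<in> outer_unit_normals K x"
proof -
  have nx: "norm (x - p) = R" using assms(2) by (simp add: dist_norm)
  have "(x - p) \<bullet> (y - x) \<le> 0" if "y \<in> K" for y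
  proof -
    have "norm (y - p) \<le> R" using assms(1) that by (auto simp: dist_norm norm_minus_commute)
    then have "(x - p) \<bullet> (y - p) \<le> R * R"
      using norm_cauchy_schwarz[of "x - p" "y - p"] nx assms(3)
      by (smt (verit) mult_left_mono)
    moreover have "(x - p) \<bullet> (x - p) = R * R" using nx by (simp add: dot_square_norm power2_eq_square)
    moreover have "(x - p) \<bullet> (y - x) = (x - p) \<bullet> (y - p) - (x - p) \<bullet> (x - p)"
      by (simp add: algebra_simps)
    ultimately show ?thesis by simp
  qed
  then show ?thesis
    using nx assms(3) by (auto simp: outer_unit_normals_def divide_nonpos_nonneg)
qed

text \<open>For uniqueness: \<open>p + R *\<^sub>R u\<close> is the point of the ball farthest in
  direction \<open>u\<close>, and a short step from \<open>x\<close> towards it stays in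
  \<open>K\<close>. As \<open>u\<close> cannot increase along this step, equality holds in
  Cauchy-Schwarz for \<open>u\<close> and \<open>x - p\<close>.\<close>

lemma outer_unit_normals_of_cball:
  assumes K: "K \<subseteq> cball p R" "dist x p = R" "0 < R"
    and e: "0 < e" "cball p R \<inter> ball x e \<subseteq> K"
  shows "outer_unit_normals K x = {(1 / R) *\<^sub>R (x - p)}"
proof -
  have nx: "norm (x - p) = R" using K(2) by (simp add: dist_norm)
  have "u = (1 / R) *\<^sub>R (x - p)" if u: "u \<in> outer_unit_normals K x" for u
  proof -
    have nu: "norm u = 1" and u_le: "\<And>y. y \<in> K \<Longrightarrow> u \<bullet> (y - x) \<le> 0"
      using u by (auto simp: outer_unit_normals_def)
    define y where "y = p + R *\<^sub>R u"
    have y: "y \<in> cball p R" using nu K(3) by (simp add: y_def dist_norm)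
    have x: "x \<in> cball p R" using K(2) by (simp add: dist_commute)
    define n where "n = norm (y - x)"
    \<comment> \<open>Makes the step shorter than \<open>e\<close>; the summand 1 avoids division by
      zero when \<open>n = 0\<close>.\<close>
    define t where "t = min 1 (e / (2 * (n + 1)))"
    have "0 \<le> n" by (simp add: n_def)
    then have t: "0 < t" "t \<le> 1" using e(1) by (auto simp: t_def simp del: distrib_left_numeral)
    have "t * n \<le> e / (2 * (n + 1)) * n"
      using \<open>0 \<le> n\<close> by (intro mult_right_mono) (auto simp: t_def)
    also have "\<dots> = e * (n / (2 * (n + 1)))" by simp
    also have "\<dots> < e * 1"
      using \<open>0 \<le> n\<close> e(1) by (intro mult_strict_left_mono) (auto simp: divide_less_eq)
    finally have "norm (t *\<^sub>R (y - x)) < e" using t by (simp add: n_def)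
    then have "x + t *\<^sub>R (y - x) \<in> ball x e" by (simp add: dist_norm)
    moreover have "x + t *\<^sub>R (y - x) \<in> cball p R"
      using convexD_alt[OF convex_cball x y, of t] t by (simp add: algebra_simps)
    ultimately have "u \<bullet> (t *\<^sub>R (y - x)) \<le> 0"
      using u_le[of "x + t *\<^sub>R (y - x)"] e(2) by auto
    then have "u \<bullet> (y - x) \<le> 0" using t by (simp add: mult_le_0_iff)
    moreover have "u \<bullet> (y - x) = R * (u \<bullet> u) - u \<bullet> (x - p)"
      by (simp add: y_def algebra_simps)
    moreover have "u \<bullet> u = 1" using nu by (simp add: dot_square_norm)
    ultimately have "R \<le> u \<bullet> (x - p)" by simp
    then have "u \<bullet> (x - p) = norm u * norm (x - p)"
      using norm_cauchy_schwarz[of u "x - p"] nu nx by simp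
    then have "norm u *\<^sub>R (x - p) = norm (x - p) *\<^sub>R u" by (simp only: norm_cauchy_schwarz_eq)
    then have "x - p = R *\<^sub>R u" using nu nx by simp
    then show ?thesis using K(3) by simp
  qed
  then show ?thesis using outer_unit_normal_of_cball[OF K] by blast
qed

section \<open>Caps, edge and Gauss map of the lens\<close>

definition lens :: "real ^ 'd \<Rightarrow> real \<Rightarrow> (real ^ 'd) set" where
  "lens v R = cball (- v) R \<inter> cball v R"

lemma lens_uminus: "lens (- v) R = lens v R"
  by (auto simp: lens_def)

definition lens_cap :: "real ^ 'd \<Rightarrow> real \<Rightarrow> (real ^ 'd) set" where
  "lens_cap v R = {x. dist x (- v) = R \<and> 0 < x \<bullet> v}"

text \<open>The sign of \<open>x \<bullet> v\<close> decides which of the two balls is the binding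
  constraint: where it is positive, the ball around \<open>- v\<close>.\<close>

lemma dist_uminus_power2: "(dist x (- v))\<^sup>2 = (dist x v)\<^sup>2 + 4 * (x \<bullet> v)" for x v :: "'a::real_inner"
  by (simp add: dist_norm power2_norm_eq_inner algebra_simps inner_commute)

lemma dist_less_dist_uminus_iff: "dist x v < dist x (- v) \<longleftrightarrow> 0 < x \<bullet> v" for x v :: "'a::real_inner"
  using dist_uminus_power2[of x v] power_mono_iff[of "dist x (- v)" "dist x v" 2]
  by auto

lemma dist_eq_dist_uminus_iff: "dist x v = dist x (- v) \<longleftrightarrow> x \<bullet> v = 0" for x v :: "'a::real_inner"
  using dist_uminus_power2[of x v] power_eq_iff_eq_base[of 2 "dist x v" "dist x (- v)"]
  by simp

text \<open>A point of the cap is interior to the other ball, with slack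
  \<open>R - dist x v\<close>, so near it the lens is just the ball around
  \<open>- v\<close>.\<close>

lemma outer_unit_normals_lens_cap:
  assumes "0 < R" "x \<in> lens_cap v R"
  shows "outer_unit_normals (lens v R) x = {(1 / R) *\<^sub>R (x + v)}"
proof -
  have x: "dist x (- v) = R" "0 < x \<bullet> v" using assms(2) by (auto simp: lens_cap_def)
  then have "dist x v < R" using dist_less_dist_uminus_iff[of x v] by simp
  moreover have "cball (- v) R \<inter> ball x (R - dist x v) \<subseteq> lens v R"
  proof
    fix y assume y: "y \<in> cball (- v) R \<inter> ball x (R - dist x v)"
    then have "dist v y \<le> R" using dist_triangle[of v y x] by (auto simp: dist_commute)
    then show "y \<in> lens v R" using y by (auto simp: lens_def)
  qed
  ultimately show ?thesis
    using outer_unit_normals_of_cball[of "lens v R" "- v" R x "R - dist x v"] x assms(1)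
    by (auto simp: lens_def)
qed

lemma mem_frontier_lens_iff:
  "x \<in> frontier (lens v R) \<longleftrightarrow>
    dist x (- v) \<le> R \<and> dist x v \<le> R \<and> (R \<le> dist x (- v) \<or> R \<le> dist x v)"
proof -
  have "closed (lens v R)" by (auto simp: lens_def)
  then have "frontier (lens v R) = lens v R - ball (- v) R \<inter> ball v R"
    by (simp add: frontier_def lens_def)
  then show ?thesis by (auto simp: lens_def dist_commute)
qed

lemma lens_cap_subset_frontier: "lens_cap v R \<subseteq> frontier (lens v R)"
proof
  fix x assume "x \<in> lens_cap v R"
  then show "x \<in> frontier (lens v R)"
    using dist_less_dist_uminus_iff[of x v] by (auto simp: lens_cap_def mem_frontier_lens_iff)
qed

lemma regular_boundary_lens:
  assumes R: "0 < R" and v: "v \<noteq> 0"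
  shows "regular_boundary (lens v R) = lens_cap v R \<union> lens_cap (- v) R"
proof
  show "lens_cap v R \<union> lens_cap (- v) R \<subseteq> regular_boundary (lens v R)"
    using outer_unit_normals_lens_cap[OF R, of _ v] outer_unit_normals_lens_cap[OF R, of _ "- v"]
      lens_cap_subset_frontier[of v R] lens_cap_subset_frontier[of "- v" R]
    by (auto simp: regular_boundary_def lens_uminus)
  show "regular_boundary (lens v R) \<subseteq> lens_cap v R \<union> lens_cap (- v) R"
  proof
    fix x assume "x \<in> regular_boundary (lens v R)"
    then have x: "dist x (- v) \<le> R" "dist x v \<le> R" "dist x (- v) = R \<or> dist x v = R"
      and unique: "\<exists>!u. u \<in> outer_unit_normals (lens v R) x"
      by (auto simp: regular_boundary_def mem_frontier_lens_iff)
    consider "0 < x \<bullet> v" | "x \<bullet> v < 0" | "x \<bullet> v = 0" by linarith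
    then show "x \<in> lens_cap v R \<union> lens_cap (- v) R"
    proof cases
      case 1
      then show ?thesis using x dist_less_dist_uminus_iff[of x v] by (auto simp: lens_cap_def)
    next
      case 2
      then show ?thesis using x dist_less_dist_uminus_iff[of x "- v"] by (auto simp: lens_cap_def)
    next
      \<comment> \<open>On the edge each ball supplies a normal, and the two differ because
        \<open>v\<close> is nonzero.\<close>
      case 3
      then have "dist x v = R" "dist x (- v) = R" using x(3) dist_eq_dist_uminus_iff[of x v] by auto
      then have "(1 / R) *\<^sub>R (x - v) \<in> outer_unit_normals (lens v R) x"
        "(1 / R) *\<^sub>R (x - - v) \<in> outer_unit_normals (lens v R) x"
        using R outer_unit_normal_of_cball[of "lens v R" v R x]
          outer_unit_normal_of_cball[of "lens v R" "- v" R x] by (auto simp: lens_def)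
      then have "(1 / R) *\<^sub>R (x - v) = (1 / R) *\<^sub>R (x - - v)" using unique by blast
      then have "v = - v" using R by simp
      then have "2 *\<^sub>R v = 0" by (simp add: scaleR_2 eq_neg_iff_add_eq_0)
      then show ?thesis using v by simp
    qed
  qed
qed

lemma gauss_map_lens_cap:
  "0 < R \<Longrightarrow> x \<in> lens_cap v R \<Longrightarrow> gauss_map (lens v R) x = (1 / R) *\<^sub>R (x + v)"
  by (simp add: gauss_map_def outer_unit_normals_lens_cap)

text \<open>A single explicit formula on the whole regular boundary, from which measurability of the
  Gauss map is read off.\<close>

lemma gauss_map_lens:
  assumes "0 < R" "x \<in> lens_cap v R \<union> lens_cap (- v) R"
  shows "gauss_map (lens v R) x = (if 0 < x \<bullet> v then (1 / R) *\<^sub>R (x + v) else (1 / R) *\<^sub>R (x - v))"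
  using assms gauss_map_lens_cap[of R x v] gauss_map_lens_cap[of R x "- v"]
  by (auto simp: lens_uminus lens_cap_def)

lemma sets_lens_cap: "lens_cap v R \<in> sets borel"
proof -
  have "lens_cap v R = sphere (- v) R \<inter> {x. 0 < x \<bullet> v}"
    by (auto simp: lens_cap_def dist_commute)
  moreover have "open {x. 0 < x \<bullet> v}"
    by (intro open_Collect_less continuous_intros)
  ultimately show ?thesis by (simp add: borel_open borel_closed sets.Int)
qed

lemma hausdorff_outer_lens_cap_pos:
  fixes v :: "real ^ 'd"
  assumes v: "norm v = 1" and R: "1 < R"
  shows "0 < hausdorff_outer (CARD('d) - 1) (lens_cap v R)"
proof (rule hausdorff_outer_pos)
  \<comment> \<open>The first two conditions place the scaling factor of \<open>y\<close> between 1
    and 2; the third says that the radial projection \<open>x\<close> of \<open>y\<close> to the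
    sphere around \<open>- v\<close> satisfies \<open>0 < x \<bullet> v\<close>.\<close>
  let ?V = "{y. R < norm (y + v)} \<inter> {y. norm (y + v) < 2 * R} \<inter> {y. norm (y + v) < R * ((y + v) \<bullet> v)}"
  show "DIM(real ^ 'd) = Suc (CARD('d) - 1)" by simp
  show "0 < R" using R by simp
  show "lens_cap v R \<subseteq> sphere (- v) R" by (auto simp: lens_cap_def dist_commute)
  show "open ?V" by (intro open_Int open_Collect_less continuous_intros)
  have vv: "v \<bullet> v = 1" using v by (simp add: dot_square_norm)
  \<comment> \<open>The axis point halfway through the shell; the third condition on it reduces to
    \<open>1 < R\<close>.\<close>
  have "(3 / 2 * R - 1) *\<^sub>R v + v = (3 / 2 * R) *\<^sub>R v" by (simp add: algebra_simps)
  then have "(3 / 2 * R - 1) *\<^sub>R v \<in> ?V" using v R vv by (auto simp: abs_of_pos)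
  then show "?V \<noteq> {}" by blast
  show "?V \<subseteq> radial_shell (- v) (lens_cap v R)"
  proof
    fix y assume y: "y \<in> ?V"
    define d where "d = norm (y + v)"
    have d: "R < d" "d < 2 * R" "d < R * ((y + v) \<bullet> v)" using y by (auto simp: d_def)
    define x where "x = - v + (R / d) *\<^sub>R (y + v)"
    have "0 < d" using d R by simp
    have "dist x (- v) = R" using \<open>0 < d\<close> R by (simp add: x_def dist_norm d_def)
    moreover have "0 < x \<bullet> v"
    proof -
      have "x \<bullet> v = R * ((y + v) \<bullet> v) / d - 1"
        by (simp add: x_def inner_add_left vv algebra_simps add_divide_distrib)
      moreover have "1 < R * ((y + v) \<bullet> v) / d" using d(3) \<open>0 < d\<close> by simp
      ultimately show ?thesis by simp
    qed
    ultimately have "x \<in> lens_cap v R" by (simp add: lens_cap_def)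
    moreover have "y = - v + (d / R) *\<^sub>R (x - - v)" using \<open>0 < d\<close> R by (simp add: x_def)
    moreover have "d / R \<in> {1..2}" using d R by (simp add: field_simps)
    ultimately show "y \<in> radial_shell (- v) (lens_cap v R)"
      unfolding radial_shell_def by (intro image_eqI[of _ _ "(d / R, x)"]) auto
  qed
qed

lemma lens_in_convex_bodies:
  assumes "norm v < R"
  shows "lens v R \<in> convex_bodies"
proof -
  have "interior (lens v R) = ball (- v) R \<inter> ball v R" by (simp add: lens_def)
  moreover have "0 \<in> ball (- v) R \<inter> ball v R" using assms by (simp add: dist_norm)
  ultimately have "interior (lens v R) \<noteq> {}" by blast
  then show ?thesis
    by (auto simp: convex_bodies_def lens_def intro: convex_Int compact_Int)
qed

section \<open>The surface area measure of the lens\<close>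

lemma space_sphere_borel [simp]: "space sphere_borel = sphere 0 1"
  by (simp add: sphere_borel_def space_restrict_space)

lemma sets_surface_area_measure [simp, measurable_cong]: "sets (surface_area_measure K) = sets sphere_borel"
  by (simp add: surface_area_measure_def)

lemma space_surface_area_measure [simp]: "space (surface_area_measure K) = sphere 0 1"
  by (simp add: surface_area_measure_def)

text \<open>Both caps lie on spheres of finite measure, and a single cap already has positive
  measure; the Gauss map pushes the total mass forward unchanged.\<close>

lemma surface_area_measure_lens:
  fixes v :: "real ^ 'd"
  assumes v: "norm v = 1" and R: "1 < R"
  shows "finite_measure (surface_area_measure (lens v R))" (is ?finite)
    and "0 < surface_area (lens v R)" (is ?pos)
    and "AE u in surface_area_measure (lens v R). 1 / R < \<bar>u \<bullet> v\<bar>" (is ?AE)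
proof -
  let ?K = "lens v R" and ?H = "hausdorff_measure (CARD('d) - 1) :: (real ^ 'd) measure"
  let ?reg = "lens_cap v R \<union> lens_cap (- v) R"
  let ?\<mu> = "restrict_space ?H ?reg"
  have R0: "0 < R" using R by simp
  have reg: "regular_boundary ?K = ?reg"
    using v by (intro regular_boundary_lens R0) auto
  have S: "surface_area_measure ?K = distr ?\<mu> sphere_borel (gauss_map ?K)"
    by (simp add: surface_area_measure_def reg)
  have reg_sets: "?reg \<in> sets borel" by (intro sets.Un sets_lens_cap)
  have sp: "space ?\<mu> = ?reg" by (simp add: space_restrict_space)
  have sphere: "gauss_map ?K x \<in> sphere 0 1" if "x \<in> ?reg" for x
    using that R0 by (auto simp: gauss_map_lens lens_cap_def dist_norm)
  have "(\<lambda>x. if 0 < x \<bullet> v then (1 / R) *\<^sub>R (x + v) else (1 / R) *\<^sub>R (x - v)) \<in> borel_measurable ?H"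
    by measurable
  then have "(\<lambda>x. if 0 < x \<bullet> v then (1 / R) *\<^sub>R (x + v) else (1 / R) *\<^sub>R (x - v)) \<in> borel_measurable ?\<mu>"
    by (rule measurable_restrict_space1)
  then have "gauss_map ?K \<in> borel_measurable ?\<mu>"
    by (rule measurable_cong[THEN iffD1, rotated]) (simp only: sp gauss_map_lens[OF R0])
  then have meas: "gauss_map ?K \<in> measurable ?\<mu> sphere_borel"
    unfolding sphere_borel_def using sphere sp by (intro measurable_restrict_space2) auto
  have total: "emeasure (surface_area_measure ?K) (sphere 0 1) = hausdorff_outer (CARD('d) - 1) ?reg"
  proof -
    have "emeasure (surface_area_measure ?K) (space (surface_area_measure ?K)) = emeasure ?\<mu> (space ?\<mu>)"
      unfolding S by (simp only: space_distr emeasure_distr[OF meas sets.top] measurable_space[OF meas]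
          vimage_def Int_def) (rule arg_cong[where f="emeasure ?\<mu>"], use measurable_space[OF meas] in auto)
    also have "\<dots> = emeasure ?H ?reg"
      unfolding sp using reg_sets by (intro emeasure_restrict_space) auto
    also have "\<dots> = hausdorff_outer (CARD('d) - 1) ?reg"
      using reg_sets by (rule emeasure_hausdorff_measure)
    finally show ?thesis by simp
  qed
  have "hausdorff_outer (CARD('d) - 1) ?reg \<le> hausdorff_outer (CARD('d) - 1) (sphere (- v) R \<union> sphere v R)"
    by (rule hausdorff_outer_mono) (auto simp: lens_cap_def dist_commute)
  also have "\<dots> \<le> hausdorff_outer (CARD('d) - 1) (sphere (- v) R) + hausdorff_outer (CARD('d) - 1) (sphere v R)"
    by (rule hausdorff_outer_Un)
  also have "\<dots> < top"
    using hausdorff_outer_sphere_finite[of "CARD('d) - 1" R "v"]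
      hausdorff_outer_sphere_finite[of "CARD('d) - 1" R "- v"] R0 by simp
  finally have fin: "emeasure (surface_area_measure ?K) (sphere 0 1) < top" by (simp only: total)
  then show ?finite by (intro finite_measureI) auto
  have "0 < hausdorff_outer (CARD('d) - 1) (lens_cap v R)"
    by (rule hausdorff_outer_lens_cap_pos[OF v R])
  also have "\<dots> \<le> hausdorff_outer (CARD('d) - 1) ?reg" by (rule hausdorff_outer_mono) auto
  finally have "0 < emeasure (surface_area_measure ?K) (sphere 0 1)" by (simp only: total)
  then show ?pos using fin by (simp add: surface_area_def measure_def enn2real_positive_iff)
  have "1 / R < \<bar>gauss_map ?K x \<bullet> v\<bar>" if x: "x \<in> ?reg" for x
  proof -
    have vv: "v \<bullet> v = 1" using v by (simp add: dot_square_norm)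
    have "x \<bullet> v \<noteq> 0" using x by (auto simp: lens_cap_def)
    \<comment> \<open>The sign in \<open>x + v\<close> or \<open>x - v\<close> agrees with that of
      \<open>x \<bullet> v\<close>, so the contribution of \<open>v \<bullet> v = 1\<close> adds up
      without cancellation.\<close>
    then have "\<bar>gauss_map ?K x \<bullet> v\<bar> = (\<bar>x \<bullet> v\<bar> + 1) / R"
      unfolding gauss_map_lens[OF R0 x] using R0
      by (auto simp: inner_add_left inner_diff_left vv abs_divide)
    then show ?thesis using \<open>x \<bullet> v \<noteq> 0\<close> R0 by (simp add: divide_strict_right_mono)
  qed
  moreover have "{u \<in> space sphere_borel. 1 / R < \<bar>u \<bullet> v\<bar>} \<in> sets sphere_borel"
  proof -
    have "(\<lambda>u. u) \<in> measurable sphere_borel borel"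
      unfolding sphere_borel_def by (intro measurable_restrict_space1) simp
    then have "(\<lambda>u. \<bar>u \<bullet> v\<bar>) \<in> borel_measurable sphere_borel" by measurable
    then show ?thesis by measurable
  qed
  ultimately show ?AE
    unfolding S by (subst AE_distr_iff[OF meas]) (auto intro: AE_I2 simp only: sp)
qed

section \<open>Averages of the transforms\<close>

lemma sets_eq_space_sphere: "sets M = sets sphere_borel \<Longrightarrow> space M = sphere 0 1"
  using sets_eq_imp_space_eq[of M sphere_borel] by simp

lemma measurable_ident_sphere_borel [measurable]: "(\<lambda>u. u) \<in> measurable sphere_borel borel"
  unfolding sphere_borel_def by (intro measurable_restrict_space1) simp

lemma inner_sphere: "u \<in> sphere 0 1 \<Longrightarrow> v \<in> sphere 0 1 \<Longrightarrow> u \<bullet> v \<in> {-1..1}"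
  using Cauchy_Schwarz_ineq2[of u v] by auto

lemma integrable_continuous_on_sphere:
  fixes f :: "real ^ 'd \<Rightarrow> real"
  assumes f: "continuous_on (sphere 0 1) f" and M: "finite_measure M" "sets M = sets sphere_borel"
  shows "integrable M f"
proof -
  obtain b where b: "\<And>u. u \<in> sphere 0 1 \<Longrightarrow> norm (f u) \<le> b"
    using continuous_on_compact_bound[OF compact_sphere f] by blast
  have "f \<in> borel_measurable sphere_borel"
    unfolding sphere_borel_def by (rule borel_measurable_continuous_on_restrict[OF f])
  then have "f \<in> borel_measurable M"
    using measurable_cong_sets[OF M(2) refl] by blast
  then show ?thesis
    using b sets_eq_space_sphere[OF M(2)]
    by (intro finite_measure.integrable_const_bound[OF M(1), where B=b] AE_I2) auto
qed

section \<open>Kernel integrals on the sphere\<close>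

context
  fixes \<psi> :: "real \<Rightarrow> real"
  assumes cont: "continuous_on {-1..1} \<psi>"
begin

lemma kernel_bounded: obtains b where "\<And>t. t \<in> {-1..1} \<Longrightarrow> \<bar>\<psi> t\<bar> \<le> b"
  using continuous_on_compact_bound[OF compact_Icc cont] by (metis real_norm_def)

lemma continuous_on_kernel:
  assumes "w \<in> sphere 0 1"
  shows "continuous_on (sphere 0 1) (\<lambda>u. \<psi> (u \<bullet> w))"
  by (rule continuous_on_compose2[OF cont])
     (use inner_sphere[OF _ assms] in \<open>auto intro!: continuous_intros\<close>)

text \<open>Continuity of \<psi> is given only on \<open>{-1..1}\<close>. Clamping the argument
  yields a function continuous on the whole line that agrees with \<psi> on inner products of unit
  vectors.\<close>

lemma measurable_kernel:
  "(\<lambda>(u, v). \<psi> (u \<bullet> v)) \<in> borel_measurable (sphere_borel \<Otimes>\<^sub>M (sphere_borel :: (real ^ 'd) measure))"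
proof -
  define \<phi> where "\<phi> t = \<psi> (max (-1) (min 1 t))" for t
  have "continuous_on UNIV \<phi>"
    unfolding \<phi>_def by (rule continuous_on_compose2[OF cont]) (auto intro!: continuous_intros)
  then have [measurable]: "\<phi> \<in> borel_measurable borel" by (rule borel_measurable_continuous_onI)
  have "(\<lambda>(u, v). \<phi> (u \<bullet> v)) \<in> borel_measurable (sphere_borel \<Otimes>\<^sub>M (sphere_borel :: (real ^ 'd) measure))"
    by measurable
  moreover have "\<phi> (u \<bullet> v) = \<psi> (u \<bullet> v)" if "u \<in> sphere 0 1" "v \<in> sphere 0 1" for u v :: "real ^ 'd"
  proof -
    have "max (-1) (min 1 (u \<bullet> v)) = u \<bullet> v" using inner_sphere[OF that] by auto
    then show ?thesis by (simp only: \<phi>_def)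
  qed
  ultimately show ?thesis
    by (subst measurable_cong[where g="\<lambda>(u, v). \<phi> (u \<bullet> v)"]) (auto simp: space_pair_measure)
qed

text \<open>Dominated convergence along sequences, with a bound of \<psi> on \<open>{-1..1}\<close>
  as majorant.\<close>

lemma continuous_on_kernel_integral:
  assumes P: "finite_measure P" "sets P = sets (sphere_borel :: (real ^ 'd) measure)"
  shows "continuous_on (sphere 0 1) (\<lambda>v. \<integral>u. \<psi> (u \<bullet> v) \<partial>P)"
  unfolding continuous_on_sequentially comp_def
proof (intro allI ballI impI, elim conjE)
  fix x :: "nat \<Rightarrow> real ^ 'd" and a
  assume a: "a \<in> sphere 0 1" and x: "\<forall>n. x n \<in> sphere 0 1" "x \<longlonglongrightarrow> a"
  obtain b where b: "\<And>t. t \<in> {-1..1} \<Longrightarrow> \<bar>\<psi> t\<bar> \<le> b" using kernel_bounded by blast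
  note space = sets_eq_space_sphere[OF P(2)]
  have int: "integrable P (\<lambda>u. \<psi> (u \<bullet> w))" if "w \<in> sphere 0 1" for w
    using continuous_on_kernel[OF that] P by (rule integrable_continuous_on_sphere)
  show "(\<lambda>n. \<integral>u. \<psi> (u \<bullet> x n) \<partial>P) \<longlonglongrightarrow> (\<integral>u. \<psi> (u \<bullet> a) \<partial>P)"
  proof (rule integral_dominated_convergence[where w="\<lambda>_. b"])
    show "integrable P (\<lambda>_. b)" by (rule finite_measure.integrable_const[OF P(1)])
    show "(\<lambda>u. \<psi> (u \<bullet> a)) \<in> borel_measurable P" using int[OF a] by simp
    show "(\<lambda>u. \<psi> (u \<bullet> x n)) \<in> borel_measurable P" for n using int x(1) by simp
    show "AE u in P. (\<lambda>n. \<psi> (u \<bullet> x n)) \<longlonglongrightarrow> \<psi> (u \<bullet> a)"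
    proof (rule AE_I2)
      fix u assume "u \<in> space P"
      then have u: "u \<in> sphere 0 1" by (simp add: space)
      show "(\<lambda>n. \<psi> (u \<bullet> x n)) \<longlonglongrightarrow> \<psi> (u \<bullet> a)"
      proof (rule continuous_on_tendsto_compose[OF cont])
        show "(\<lambda>n. u \<bullet> x n) \<longlonglongrightarrow> u \<bullet> a" by (intro tendsto_inner tendsto_const x(2))
        show "\<forall>\<^sub>F n in sequentially. u \<bullet> x n \<in> {-1..1}" using inner_sphere[OF u] x(1) by simp
      qed (rule inner_sphere[OF u a])
    qed
    show "AE u in P. norm (\<psi> (u \<bullet> x n)) \<le> b" for n
      using x(1) by (intro AE_I2) (simp only: space real_norm_def b inner_sphere)
  qed
qed

lemma kernel_integral_swap:
  assumes P: "finite_measure P" "sets P = sets (sphere_borel :: (real ^ 'd) measure)"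
    and N: "finite_measure N" "sets N = sets (sphere_borel :: (real ^ 'd) measure)"
  shows "(\<integral>u. (\<integral>v. \<psi> (u \<bullet> v) \<partial>N) \<partial>P) = (\<integral>v. (\<integral>u. \<psi> (u \<bullet> v) \<partial>P) \<partial>N)"
proof -
  interpret P: finite_measure P by fact
  interpret N: finite_measure N by fact
  interpret PN: pair_sigma_finite P N ..
  interpret F: finite_measure "P \<Otimes>\<^sub>M N" by (rule finite_measure_pair_measure) fact+
  obtain b where b: "\<And>t. t \<in> {-1..1} \<Longrightarrow> \<bar>\<psi> t\<bar> \<le> b" using kernel_bounded by blast
  have "(\<lambda>(u, v). \<psi> (u \<bullet> v)) \<in> borel_measurable (P \<Otimes>\<^sub>M N)"
    using measurable_kernel measurable_cong_sets[OF sets_pair_measure_cong[OF P(2) N(2)] refl] by blast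
  moreover have "AE x in P \<Otimes>\<^sub>M N. norm (case x of (u, v) \<Rightarrow> \<psi> (u \<bullet> v)) \<le> b"
    using b inner_sphere sets_eq_space_sphere[OF P(2)] sets_eq_space_sphere[OF N(2)]
    by (intro AE_I2) (auto simp: space_pair_measure simp del: mem_sphere mem_sphere_0 atLeastAtMost_iff)
  ultimately have "integrable (P \<Otimes>\<^sub>M N) (\<lambda>(u, v). \<psi> (u \<bullet> v))"
    by (intro F.integrable_const_bound)
  then show ?thesis by (rule PN.Fubini_integral[symmetric])
qed

lemma continuous_on_T_transform:
  assumes \<nu>: "finite_signed_measure (sphere_borel :: (real ^ 'd) measure) \<nu>"
  shows "continuous_on (sphere 0 1) (T_transform \<psi> \<nu>)"
  unfolding T_transform_def signed_integral_def
  using finite_measure_positive_part[OF \<nu>] finite_measure_positive_part[OF finite_signed_measure_uminus[OF \<nu>]]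
  by (intro continuous_on_diff continuous_on_kernel_integral) auto

lemma continuous_on_B_transform:
  fixes K :: "(real ^ 'd) set"
  assumes "finite_measure (surface_area_measure K)"
  shows "continuous_on (sphere 0 1) (B_transform \<psi> K)"
  unfolding B_transform_def
  using continuous_on_kernel_integral[OF assms]
  by (intro continuous_on_mult_left) (simp add: inner_commute)

text \<open>Fubini is applied to the two Jordan parts separately, since each is a finite
  measure.\<close>

lemma signed_integral_B_transform:
  fixes K :: "(real ^ 'd) set"
  assumes N: "finite_measure (surface_area_measure K)" and \<nu>: "finite_signed_measure sphere_borel \<nu>"
  shows "signed_integral sphere_borel \<nu> (B_transform \<psi> K)
    = 1/2 * (\<integral>v. T_transform \<psi> \<nu> v \<partial>surface_area_measure K)"
proof -
  have half: "(\<integral>u. B_transform \<psi> K u \<partial>P) = 1/2 * (\<integral>v. (\<integral>u. \<psi> (u \<bullet> v) \<partial>P) \<partial>surface_area_measure K)"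
    if "finite_measure P" "sets P = sets sphere_borel" for P
    unfolding B_transform_def
    using kernel_integral_swap[OF that N] by simp
  note P = finite_measure_positive_part[OF \<nu>]
    finite_measure_positive_part[OF finite_signed_measure_uminus[OF \<nu>]]
  have int: "integrable (surface_area_measure K) (\<lambda>v. \<integral>u. \<psi> (u \<bullet> v) \<partial>P)"
    if "finite_measure P" "sets P = sets sphere_borel" for P
    using that N by (intro integrable_continuous_on_sphere continuous_on_kernel_integral) auto
  show ?thesis
    unfolding signed_integral_def T_transform_def
    using int[OF P(1)] int[OF P(2)]
    by (simp add: half P Bochner_Integration.integral_diff algebra_simps)
qed

text \<open>Finiteness of the surface area measure makes \<open>B_transform \<psi> K\<close>
  continuous, hence bounded and measurable, as splitting the integral over the difference
  requires.\<close>

lemma average_difference: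
  fixes K :: "(real ^ 'd) set"
  assumes N: "finite_measure (surface_area_measure K)"
    and \<mu>: "finite_signed_measure sphere_borel \<mu>"
    and \<sigma>: "finite_measure \<sigma>" "sets \<sigma> = sets sphere_borel"
  shows "signed_integral sphere_borel \<mu> (B_transform \<psi> K) - (\<integral>u. B_transform \<psi> K u \<partial>\<sigma>)
    = 1/2 * (\<integral>v. T_transform \<psi> (\<lambda>A. \<mu> A - measure \<sigma> A) v \<partial>surface_area_measure K)"
proof -
  have B: "continuous_on (sphere 0 1) (B_transform \<psi> K)" by (rule continuous_on_B_transform[OF N])
  obtain b where "\<And>u. u \<in> sphere 0 1 \<Longrightarrow> \<bar>B_transform \<psi> K u\<bar> \<le> b"
    using continuous_on_compact_bound[OF compact_sphere B] by (metis real_norm_def)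
  moreover have "B_transform \<psi> K \<in> borel_measurable sphere_borel"
    unfolding sphere_borel_def by (rule borel_measurable_continuous_on_restrict[OF B])
  ultimately show ?thesis
    using signed_integral_diff_measure[OF \<mu> \<sigma>, of "B_transform \<psi> K" b]
      signed_integral_B_transform[OF N finite_signed_measure_diff_measure[OF \<mu> \<sigma>]]
    by simp
qed

lemma T_transform_uminus:
  assumes even: "\<And>t. t \<in> {-1..1} \<Longrightarrow> \<psi> (- t) = \<psi> t" and v: "v \<in> sphere 0 1"
  shows "T_transform \<psi> \<nu> (- v) = T_transform \<psi> \<nu> v"
  unfolding T_transform_def signed_integral_def
  by (intro arg_cong2[where f="(-)"] Bochner_Integration.integral_cong refl)
     (use even inner_sphere[OF _ v] in \<open>auto simp del: mem_sphere mem_sphere_0 atLeastAtMost_iff\<close>)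

end

text \<open>
  All normals of the lens at regular boundary points lie close to \<open>\<plusminus>v\<close> if \<open>R\<close> is close to \<open>1\<close>,
  so that averaging an even continuous function over its surface area measure nearly evaluates
  the function at \<open>v\<close>.
\<close>
lemma surface_area_average_near_value:
  fixes f :: "real ^ 'd \<Rightarrow> real"
  assumes f: "continuous_on (sphere 0 1) f" and even: "\<And>u. u \<in> sphere 0 1 \<Longrightarrow> f (- u) = f u"
    and v: "v \<in> sphere 0 1" and e: "0 < e"
  obtains K where "K \<in> convex_bodies" "finite_measure (surface_area_measure K)" "0 < surface_area K"
    "\<bar>(\<integral>u. f u \<partial>surface_area_measure K) - f v * surface_area K\<bar> \<le> e * surface_area K"
proof -
  have nv: "norm v = 1" using v by simp
  obtain \<delta> where \<delta>: "0 < \<delta>" "\<And>w. w \<in> sphere 0 1 \<Longrightarrow> dist w v < \<delta> \<Longrightarrow> dist (f w) (f v) < e"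
    using f v e unfolding continuous_on_iff by metis
  \<comment> \<open>For unit vectors the squared distance is \<open>2 - 2 * (w \<bullet> v)\<close>.
    Since \<open>2 - 2 / R < 2 * (R - 1)\<close>, this \<open>R\<close> makes
    \<open>1 / R < w \<bullet> v\<close> imply \<open>dist w v < \<delta>\<close>.\<close>
  define R where "R = 1 + \<delta>\<^sup>2 / 2"
  have R: "1 < R" using \<delta>(1) by (simp add: R_def)
  have R_le: "2 - 2 / R < \<delta>\<^sup>2"
  proof -
    have "2 - 2 / R = 2 * (R - 1) / R" using R by (simp add: field_simps)
    also have "\<dots> < 2 * (R - 1) / 1" using R by (intro divide_strict_left_mono) auto
    finally show ?thesis by (simp add: R_def)
  qed
  have near: "\<bar>f w - f v\<bar> \<le> e" if w: "w \<in> sphere 0 1" "1 / R < w \<bullet> v" for w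
  proof -
    have "w \<bullet> w = 1" "v \<bullet> v = 1" using w(1) nv by (simp_all add: dot_square_norm)
    then have "(dist w v)\<^sup>2 = 2 - 2 * (w \<bullet> v)"
      by (simp add: dist_norm power2_norm_eq_inner inner_diff_left inner_diff_right inner_commute)
    also have "\<dots> < \<delta>\<^sup>2" using w(2) R_le by simp
    finally have "dist w v < \<delta>" using \<delta>(1) by (simp add: power2_less_imp_less)
    then show ?thesis using \<delta>(2)[OF w(1)] by (simp add: dist_real_def)
  qed
  let ?K = "lens v R"
  let ?S = "surface_area_measure ?K"
  note lens = surface_area_measure_lens[OF nv R]
  have close: "\<bar>f u - f v\<bar> \<le> e" if u: "u \<in> sphere 0 1" "1 / R < \<bar>u \<bullet> v\<bar>" for u
  proof (cases "0 \<le> u \<bullet> v")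
    case True
    then show ?thesis using near[of u] u by simp
  next
    case False
    then show ?thesis using near[of "- u"] u even[of u] by simp
  qed
  have AE_close: "AE u in ?S. \<bar>f u - f v\<bar> \<le> e"
    using lens(3) by (rule AE_mp) (auto intro!: AE_I2 simp del: mem_sphere mem_sphere_0 simp: close)
  have int: "integrable ?S f" "integrable ?S (\<lambda>u. f u - f v)" "\<And>c. integrable ?S (\<lambda>_. c :: real)"
    using f lens(1) by (auto intro!: integrable_continuous_on_sphere continuous_intros)
  have const: "(\<integral>u. c \<partial>?S) = c * surface_area ?K" for c :: real
    by (simp add: surface_area_def)
  have "AE u in ?S. f u - f v \<le> e" "AE u in ?S. - e \<le> f u - f v"
    using AE_close by (auto elim: eventually_mono)
  then have "(\<integral>u. f u - f v \<partial>?S) \<le> (\<integral>u. e \<partial>?S)" "(\<integral>u. - e \<partial>?S) \<le> (\<integral>u. f u - f v \<partial>?S)"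
    using integral_mono_AE[OF int(2) int(3)] integral_mono_AE[OF int(3) int(2)] by blast+
  then have "\<bar>\<integral>u. f u - f v \<partial>?S\<bar> \<le> e * surface_area ?K"
    unfolding const by (simp add: abs_le_iff)
  moreover have "(\<integral>u. f u - f v \<partial>?S) = (\<integral>u. f u \<partial>?S) - f v * surface_area ?K"
    using Bochner_Integration.integral_diff[OF int(1) int(3)[of "f v"]] by (simp only: const)
  ultimately show ?thesis
    using lens_in_convex_bodies[of v R] lens nv R by (intro that[of ?K]) auto
qed

theorem theorem3p2:
  fixes \<psi> :: "real \<Rightarrow> real"
    and \<mu> :: "(real ^ 'd) set \<Rightarrow> real"
    and \<sigma> :: "(real ^ 'd) measure"
  assumes "CARD('d) \<ge> 2"
    and "continuous_on {-1..1} \<psi>"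
    and "\<And>t. t \<in> {-1..1} \<Longrightarrow> \<psi> (- t) = \<psi> t"
    and "finite_signed_measure sphere_borel \<mu>"
    and "\<mu> (sphere 0 1) = 1"
    and "rotation_invariant_prob \<sigma>"
  shows "(SUP K \<in> (convex_bodies :: (real ^ 'd) set set).
            ereal (1 / surface_area K *
              \<bar>signed_integral sphere_borel \<mu> (B_transform \<psi> K) - (\<integral>u. B_transform \<psi> K u \<partial>\<sigma>)\<bar>))
         = ereal (1/2) * sphere_sup_norm (T_transform \<psi> (\<lambda>A. \<mu> A - measure \<sigma> A))"
proof -
  have \<sigma>: "finite_measure \<sigma>" "sets \<sigma> = sets sphere_borel"
    using assms(6) by (auto simp: rotation_invariant_prob_def prob_space.finite_measure)
  note cont = assms(2) and even = assms(3) and \<mu> = assms(4)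
  define T where "T = T_transform \<psi> (\<lambda>A. \<mu> A - measure \<sigma> A)"
  define ratio where "ratio K = 1 / surface_area K *
    \<bar>signed_integral sphere_borel \<mu> (B_transform \<psi> K) - (\<integral>u. B_transform \<psi> K u \<partial>\<sigma>)\<bar>"
    for K :: "(real ^ 'd) set"
  have T_cont: "continuous_on (sphere 0 1) T"
    unfolding T_def
    by (rule continuous_on_T_transform[OF cont finite_signed_measure_diff_measure[OF \<mu> \<sigma>]])
  have T_even: "T (- v) = T v" if "v \<in> sphere 0 1" for v
    unfolding T_def using T_transform_uminus[OF cont even that] by simp
  have ratio_eq: "ratio K = \<bar>\<integral>v. T v \<partial>surface_area_measure K\<bar> / (2 * surface_area K)"
    if "finite_measure (surface_area_measure K)" for K
    unfolding ratio_def T_def average_difference[OF cont that \<mu> \<sigma>] by (simp add: abs_mult)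
  have sphere_ne: "sphere (0 :: real ^ 'd) 1 \<noteq> {}" by (simp add: sphere_eq_empty)
  have norm_upper: "ereal \<bar>T v\<bar> \<le> sphere_sup_norm T" if "v \<in> sphere 0 1" for v
    unfolding sphere_sup_norm_def using that by (rule SUP_upper)
  have nonneg: "0 \<le> sphere_sup_norm T"
    using sphere_ne norm_upper by (metis abs_ge_zero ereal_less_eq(5) ex_in_conv order_trans)
  have upper: "ereal (ratio K) \<le> ereal (1/2) * sphere_sup_norm T" for K
  proof (cases "sphere_sup_norm T")
    \<comment> \<open>An infinite norm makes the bound trivial, and minus infinity is excluded by
      \<open>nonneg\<close>.\<close>
    case (real c)
    have c: "0 \<le> c" "\<And>v. v \<in> sphere 0 1 \<Longrightarrow> \<bar>T v\<bar> \<le> c"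
      using nonneg norm_upper by (auto simp: real)
    show ?thesis
    proof (cases "surface_area K = 0")
      case True
      then show ?thesis using c(1) by (simp add: ratio_def real)
    next
      case False
      \<comment> \<open>An infinite surface area measure would have \<open>surface_area K = 0\<close>.\<close>
      then have pos: "0 < surface_area K" by (simp add: surface_area_def less_le)
      have fin: "finite_measure (surface_area_measure K)"
        using False by (intro finite_measureI) (auto simp: surface_area_def measure_def)
      have int: "integrable (surface_area_measure K) T"
        by (rule integrable_continuous_on_sphere[OF T_cont fin]) simp
      have "\<bar>\<integral>v. T v \<partial>surface_area_measure K\<bar> \<le> (\<integral>v. \<bar>T v\<bar> \<partial>surface_area_measure K)"
        by (rule integral_abs_bound)
      also have "\<dots> \<le> (\<integral>v. c \<partial>surface_area_measure K)"
        using int c(2) finite_measure.integrable_const[OF fin] by (intro integral_mono) auto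
      also have "\<dots> = c * surface_area K" by (simp add: surface_area_def)
      finally have "ratio K \<le> c / 2" using pos by (simp add: ratio_eq[OF fin] field_simps)
      then show ?thesis by (simp add: real)
    qed
  qed (use nonneg in auto)
  have lower: "ereal (1/2 * \<bar>T v\<bar>) \<le> (SUP K\<in>convex_bodies. ereal (ratio K))"
    if v: "v \<in> sphere 0 1" for v
  proof (rule ereal_le_epsilon2)
    fix e :: real assume e: "0 < e"
    obtain K where K: "K \<in> convex_bodies" "finite_measure (surface_area_measure K)" "0 < surface_area K"
      "\<bar>(\<integral>u. T u \<partial>surface_area_measure K) - T v * surface_area K\<bar> \<le> e * surface_area K"
      using surface_area_average_near_value[OF T_cont T_even v e] by blast
    have "\<bar>T v\<bar> * surface_area K = \<bar>T v * surface_area K\<bar>" using K(3) by (simp add: abs_mult)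
    also have "\<dots> \<le> \<bar>\<integral>u. T u \<partial>surface_area_measure K\<bar> + e * surface_area K" using K(4) by linarith
    finally have "\<bar>T v\<bar> \<le> 2 * ratio K + e" using K(3) by (simp add: ratio_eq[OF K(2)] field_simps)
    \<comment> \<open>Halving leaves the error \<open>e / 2\<close>, which is enlarged to
      \<open>e\<close>.\<close>
    then have "ereal (1/2 * \<bar>T v\<bar>) \<le> ereal (ratio K) + ereal e" using e by simp
    also have "\<dots> \<le> (SUP K\<in>convex_bodies. ereal (ratio K)) + ereal e"
      using K(1) by (intro add_right_mono SUP_upper)
    finally show "ereal (1/2 * \<bar>T v\<bar>) \<le> (SUP K\<in>convex_bodies. ereal (ratio K)) + ereal e" .
  qed
  have "(SUP K\<in>convex_bodies. ereal (ratio K)) = ereal (1/2) * sphere_sup_norm T"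
  proof (rule antisym)
    show "(SUP K\<in>convex_bodies. ereal (ratio K)) \<le> ereal (1/2) * sphere_sup_norm T"
      by (intro SUP_least upper)
    have "ereal (1/2) * sphere_sup_norm T = (SUP v\<in>sphere 0 1. ereal (1/2) * ereal \<bar>T v\<bar>)"
      unfolding sphere_sup_norm_def by (rule SUP_ereal_mult_left[OF sphere_ne, symmetric]) auto
    also have "\<dots> \<le> (SUP K\<in>convex_bodies. ereal (ratio K))"
      using lower by (intro SUP_least) simp
    finally show "ereal (1/2) * sphere_sup_norm T \<le> (SUP K\<in>convex_bodies. ereal (ratio K))" .
  qed
  then show ?thesis unfolding ratio_def T_def .
qed

end
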